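(* The canonical model $\mathcal{M}^c=\langle W^c,R^c,\mathrm{Val}^c\rangle$ of $\mathrm{PDL}_n$ is a non standard $n+1$-valued Kripke model. That is, the map $\mathrm{Val}^c$ on $W^c\times\mathsf{Form}$ is the extension of its restriction to $W^c\times\mathsf{Prop}$ by the clauses $\mathrm{Val}(w,0)=0$, $\mathrm{Val}(w,\phi\to\psi)=\mathrm{Val}(w,\phi)\to\mathrm{Val}(w,\psi)$, $\mathrm{Val}(w,\neg\psi)=1-\mathrm{Val}(w,\psi)$, $\mathrm{Val}(w,[\alpha]\psi)=\bigwedge\{\mathrm{Val}(v,\psi):(w,v)\in R^c_\alpha\}$, and for all programs $\alpha,\beta$ and formulas $\psi,\phi$: (i) $R^c_{\alpha;\beta}=R^c_\alpha\circ R^c_\beta$, $R^c_{\alpha\cup\beta}=R^c_\alpha\cup R^c_\beta$, $R^c_{\psi?}=\{(u,u):\mathrm{Val}^c(u,\psi)=1\}$; (ii) $R^c_{\alpha^*}$ is reflexive, transitive and contains $R^c_\alpha$; (iii) the formulas $[\alpha^*]\phi\to(\phi\wedge[\alpha][\alpha^*]\phi)$, $[\alpha^*]\phi\to[\alpha^*][\alpha^*]\phi$ and $(\phi\wedge[\alpha^*](\phi\to[\alpha]\phi)^n)\to[\alpha^*]\phi$ take value $1$ at every $u\in W^c$.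
   Context: Language: nonempty $\Pi_0$ of atomic programs, countable $\mathsf{Prop}$; formulas $\phi::=p\mid0\mid\neg\phi\mid\phi\to\phi\mid[\alpha]\phi$, programs $\alpha::=a\mid\phi?\mid\alpha;\alpha\mid\alpha\cup\alpha\mid\alpha^*$; $1:=\neg0$; abbreviations $\phi\vee\psi:=(\phi\to\psi)\to\psi$, $\phi\wedge\psi:=\neg(\neg\phi\vee\neg\psi)$, $\phi\oplus\psi:=\neg\phi\to\psi$, $\phi\odot\psi:=\neg(\neg\phi\oplus\neg\psi)$, $\phi\leftrightarrow\psi:=(\phi\to\psi)\odot(\psi\to\phi)$, $\psi^k$ the $\odot$-product of $k$ copies. $\mathrm{L}_n=\{i/n:0\le i\le n\}$ with $\neg x=1-x$, $x\to y=\min(1-x+y,1)$. Composition: $R\circ R'=\{(u,w):\exists v\,(uRv\,\&\,vR'w)\}$. $\mathrm{PDL}_n$: the smallest set of formulas closed under modus ponens, uniform substitution and necessitation (from $\phi$ infer $[\alpha]\phi$), containing all tautologies of $n+1$-valued Łukasiewicz logic and, for all programs $\alpha,\beta$: $[\alpha](p\to q)\to([\alpha]p\to[\alpha]q)$, $[\alpha](p\oplus p)\leftrightarrow([\alpha]p\oplus[\alpha]p)$, $[\alpha](p\odot p)\leftrightarrow([\alpha]p\odot[\alpha]p)$, $[\alpha\cup\beta]p\leftrightarrow([\alpha]p\wedge[\beta]p)$, $[\alpha;\beta]p\leftrightarrow[\alpha][\beta]p$, $[q?]p\leftrightarrow(\neg q^n\vee p)$, $[\alpha^*]p\leftrightarrow(p\wedge[\alpha][\alpha^*]p)$,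 $[\alpha^*]p\to[\alpha^*][\alpha^*]p$, $(p\wedge[\alpha^*](p\to[\alpha]p)^n)\to[\alpha^*]p$. $\mathcal{F}_n$ is $\mathsf{Form}$ modulo $\phi\equiv\psi$ iff $\phi\leftrightarrow\psi\in\mathrm{PDL}_n$. Canonical model: $W^c$ is the set of MV-algebra homomorphisms $u:\mathcal{F}_n\to\mathrm{L}_n$ (preserving $\to,\neg,1$); for every $\alpha\in\Pi$, $R^c_\alpha=\{(u,v):\forall\phi\ (u([\alpha]\phi)=1\Rightarrow v(\phi)=1)\}$; $\mathrm{Val}^c(u,\phi)=u(\phi)$ for all formulas $\phi$. *)

theory Defs
  imports Complex_Main "HOL-Library.Countable" "HOL-Library.FuncSet"
begin

datatype ('a, 'p) form =
    PVar 'p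
  | Falsum ("\<^bold>0")
  | Neg "('a, 'p) form" ("\<^bold>\<not> _" [80] 80)
  | Imp "('a, 'p) form" "('a, 'p) form" (infixr "\<^bold>\<rightarrow>" 55)
  | Box "('a, 'p) prog" "('a, 'p) form" ("\<^bold>[_\<^bold>] _" [0, 80] 80)
and ('a, 'p) prog =
    Atom 'a
  | Test "('a, 'p) form"
  | Seq "('a, 'p) prog" "('a, 'p) prog"
  | Choice "('a, 'p) prog" "('a, 'p) prog"
  | Star "('a, 'p) prog"

abbreviation Verum :: "('a, 'p) form" ("\<^bold>1") where
  "\<^bold>1 \<equiv> \<^bold>\<not> \<^bold>0"

abbreviation Or :: "('a, 'p) form \<Rightarrow> ('a, 'p) form \<Rightarrow> ('a, 'p) form" (infixr "\<^bold>\<or>" 60) where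
  "\<phi> \<^bold>\<or> \<psi> \<equiv> (\<phi> \<^bold>\<rightarrow> \<psi>) \<^bold>\<rightarrow> \<psi>"

abbreviation And :: "('a, 'p) form \<Rightarrow> ('a, 'p) form \<Rightarrow> ('a, 'p) form" (infixr "\<^bold>\<and>" 65) where
  "\<phi> \<^bold>\<and> \<psi> \<equiv> \<^bold>\<not> (\<^bold>\<not> \<phi> \<^bold>\<or> \<^bold>\<not> \<psi>)"

abbreviation Oplus :: "('a, 'p) form \<Rightarrow> ('a, 'p) form \<Rightarrow> ('a, 'p) form" (infixr "\<^bold>\<oplus>" 60) where
  "\<phi> \<^bold>\<oplus> \<psi> \<equiv> \<^bold>\<not> \<phi> \<^bold>\<rightarrow> \<psi>"

abbreviation Odot :: "('a, 'p) form \<Rightarrow> ('a, 'p) form \<Rightarrow> ('a, 'p) form" (infixr "\<^bold>\<odot>" 65) where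
  "\<phi> \<^bold>\<odot> \<psi> \<equiv> \<^bold>\<not> (\<^bold>\<not> \<phi> \<^bold>\<oplus> \<^bold>\<not> \<psi>)"

abbreviation Iff :: "('a, 'p) form \<Rightarrow> ('a, 'p) form \<Rightarrow> ('a, 'p) form" (infix "\<^bold>\<leftrightarrow>" 54) where
  "\<phi> \<^bold>\<leftrightarrow> \<psi> \<equiv> (\<phi> \<^bold>\<rightarrow> \<psi>) \<^bold>\<odot> (\<psi> \<^bold>\<rightarrow> \<phi>)"

fun odot_power :: "('a, 'p) form \<Rightarrow> nat \<Rightarrow> ('a, 'p) form" where
  "odot_power \<phi> 0 = \<^bold>1"
| "odot_power \<phi> (Suc 0) = \<phi>"
| "odot_power \<phi> (Suc (Suc k)) = \<phi> \<^bold>\<odot> odot_power \<phi> (Suc k)"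

text \<open>Uniform substitution also acts on variables occurring inside tests.\<close>

primrec subst_form :: "('p \<Rightarrow> ('a, 'p) form) \<Rightarrow> ('a, 'p) form \<Rightarrow> ('a, 'p) form"
  and subst_prog :: "('p \<Rightarrow> ('a, 'p) form) \<Rightarrow> ('a, 'p) prog \<Rightarrow> ('a, 'p) prog" where
  "subst_form \<sigma> (PVar p) = \<sigma> p"
| "subst_form \<sigma> \<^bold>0 = \<^bold>0"
| "subst_form \<sigma> (\<^bold>\<not> \<phi>) = \<^bold>\<not> (subst_form \<sigma> \<phi>)"
| "subst_form \<sigma> (\<phi> \<^bold>\<rightarrow> \<psi>) = subst_form \<sigma> \<phi> \<^bold>\<rightarrow> subst_form \<sigma> \<psi>"
| "subst_form \<sigma> (\<^bold>[\<alpha>\<^bold>] \<phi>) = \<^bold>[subst_prog \<sigma> \<alpha>\<^bold>] (subst_form \<sigma> \<phi>)"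
| "subst_prog \<sigma> (Atom a) = Atom a"
| "subst_prog \<sigma> (Test \<phi>) = Test (subst_form \<sigma> \<phi>)"
| "subst_prog \<sigma> (Seq \<alpha> \<beta>) = Seq (subst_prog \<sigma> \<alpha>) (subst_prog \<sigma> \<beta>)"
| "subst_prog \<sigma> (Choice \<alpha> \<beta>) = Choice (subst_prog \<sigma> \<alpha>) (subst_prog \<sigma> \<beta>)"
| "subst_prog \<sigma> (Star \<alpha>) = Star (subst_prog \<sigma> \<alpha>)"

definition Luk :: "nat \<Rightarrow> real set" where
  "Luk n = {real i / real n | i. i \<le> n}"

definition luk_neg :: "real \<Rightarrow> real" where
  "luk_neg x = 1 - x"

definition luk_imp :: "real \<Rightarrow> real \<Rightarrow> real" where
  "luk_imp x y = min (1 - x + y) 1"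

text \<open>The meet in the chain \<open>Luk n\<close>; the empty meet is the top element
  \<open>1\<close>, whereas \<open>Inf {}\<close> is not \<open>1\<close> on the type of reals.\<close>

definition luk_Meet :: "real set \<Rightarrow> real" where
  "luk_Meet A = (if A = {} then 1 else Inf A)"

text \<open>Formulas of propositional Lukasiewicz logic, i.e. the fragment without programs.\<close>

datatype 'p lform = LVar 'p | LFalsum | LNeg "'p lform" | LImp "'p lform" "'p lform"

primrec luk_eval :: "('p \<Rightarrow> real) \<Rightarrow> 'p lform \<Rightarrow> real" where
  "luk_eval v (LVar p) = v p"
| "luk_eval v LFalsum = 0"
| "luk_eval v (LNeg \<phi>) = luk_neg (luk_eval v \<phi>)"
| "luk_eval v (LImp \<phi> \<psi>) = luk_imp (luk_eval v \<phi>) (luk_eval v \<psi>)"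

definition luk_tautology :: "nat \<Rightarrow> 'p lform \<Rightarrow> bool" where
  "luk_tautology n \<phi> \<longleftrightarrow> (\<forall>v. (\<forall>p. v p \<in> Luk n) \<longrightarrow> luk_eval v \<phi> = 1)"

primrec form_of_lform :: "'p lform \<Rightarrow> ('a, 'p) form" where
  "form_of_lform (LVar p) = PVar p"
| "form_of_lform LFalsum = \<^bold>0"
| "form_of_lform (LNeg \<phi>) = \<^bold>\<not> (form_of_lform \<phi>)"
| "form_of_lform (LImp \<phi> \<psi>) = form_of_lform \<phi> \<^bold>\<rightarrow> form_of_lform \<psi>"

inductive_set PDL :: "nat \<Rightarrow> ('a, 'p) form set" for n :: nat where
  mp: "\<phi> \<in> PDL n \<Longrightarrow> \<phi> \<^bold>\<rightarrow> \<psi> \<in> PDL n \<Longrightarrow> \<psi> \<in> PDL n"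
| subst: "\<phi> \<in> PDL n \<Longrightarrow> subst_form \<sigma> \<phi> \<in> PDL n"
| nec: "\<phi> \<in> PDL n \<Longrightarrow> \<^bold>[\<alpha>\<^bold>] \<phi> \<in> PDL n"
| taut: "luk_tautology n \<tau> \<Longrightarrow> form_of_lform \<tau> \<in> PDL n"
| K: "\<^bold>[\<alpha>\<^bold>] (PVar p \<^bold>\<rightarrow> PVar q) \<^bold>\<rightarrow> (\<^bold>[\<alpha>\<^bold>] PVar p \<^bold>\<rightarrow> \<^bold>[\<alpha>\<^bold>] PVar q) \<in> PDL n"
| box_oplus: "\<^bold>[\<alpha>\<^bold>] (PVar p \<^bold>\<oplus> PVar p) \<^bold>\<leftrightarrow> (\<^bold>[\<alpha>\<^bold>] PVar p \<^bold>\<oplus> \<^bold>[\<alpha>\<^bold>] PVar p) \<in> PDL n"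
| box_odot: "\<^bold>[\<alpha>\<^bold>] (PVar p \<^bold>\<odot> PVar p) \<^bold>\<leftrightarrow> (\<^bold>[\<alpha>\<^bold>] PVar p \<^bold>\<odot> \<^bold>[\<alpha>\<^bold>] PVar p) \<in> PDL n"
| choice: "\<^bold>[Choice \<alpha> \<beta>\<^bold>] PVar p \<^bold>\<leftrightarrow> (\<^bold>[\<alpha>\<^bold>] PVar p \<^bold>\<and> \<^bold>[\<beta>\<^bold>] PVar p) \<in> PDL n"
| seq: "\<^bold>[Seq \<alpha> \<beta>\<^bold>] PVar p \<^bold>\<leftrightarrow> \<^bold>[\<alpha>\<^bold>] \<^bold>[\<beta>\<^bold>] PVar p \<in> PDL n"
| test: "\<^bold>[Test (PVar q)\<^bold>] PVar p \<^bold>\<leftrightarrow> (\<^bold>\<not> (odot_power (PVar q) n) \<^bold>\<or> PVar p) \<in> PDL n"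
| star_unfold: "\<^bold>[Star \<alpha>\<^bold>] PVar p \<^bold>\<leftrightarrow> (PVar p \<^bold>\<and> \<^bold>[\<alpha>\<^bold>] \<^bold>[Star \<alpha>\<^bold>] PVar p) \<in> PDL n"
| star_trans: "\<^bold>[Star \<alpha>\<^bold>] PVar p \<^bold>\<rightarrow> \<^bold>[Star \<alpha>\<^bold>] \<^bold>[Star \<alpha>\<^bold>] PVar p \<in> PDL n"
| star_ind: "(PVar p \<^bold>\<and> \<^bold>[Star \<alpha>\<^bold>] (odot_power (PVar p \<^bold>\<rightarrow> \<^bold>[\<alpha>\<^bold>] PVar p) n))
      \<^bold>\<rightarrow> \<^bold>[Star \<alpha>\<^bold>] PVar p \<in> PDL n"

definition pdl_equiv :: "nat \<Rightarrow> (('a, 'p) form \<times> ('a, 'p) form) set" where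
  "pdl_equiv n = {(\<phi>, \<psi>). \<phi> \<^bold>\<leftrightarrow> \<psi> \<in> PDL n}"

definition pdl_class :: "nat \<Rightarrow> ('a, 'p) form \<Rightarrow> ('a, 'p) form set" where
  "pdl_class n \<phi> = pdl_equiv n `` {\<phi>}"

definition Lindenbaum :: "nat \<Rightarrow> ('a, 'p) form set set" where
  "Lindenbaum n = UNIV // pdl_equiv n"

text \<open>The operations of the Lindenbaum algebra are those induced on classes by the
  connectives, so that preservation is stated on representatives. Homomorphisms are
  extensional functions, so that equality of worlds is equality of maps on the algebra.\<close>

definition canonical_worlds :: "nat \<Rightarrow> (('a, 'p) form set \<Rightarrow> real) set" where
  "canonical_worlds n = {u \<in> Lindenbaum n \<rightarrow>\<^sub>E Luk n.
     (\<forall>\<phi> \<psi>. u (pdl_class n (\<phi> \<^bold>\<rightarrow> \<psi>)) = luk_imp (u (pdl_class n \<phi>)) (u (pdl_class n \<psi>))) \<and>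
     (\<forall>\<phi>. u (pdl_class n (\<^bold>\<not> \<phi>)) = luk_neg (u (pdl_class n \<phi>))) \<and>
     u (pdl_class n \<^bold>1) = 1}"

definition canonical_val :: "nat \<Rightarrow> (('a, 'p) form set \<Rightarrow> real) \<Rightarrow> ('a, 'p) form \<Rightarrow> real" where
  "canonical_val n u \<phi> = u (pdl_class n \<phi>)"

definition canonical_rel ::
    "nat \<Rightarrow> ('a, 'p) prog \<Rightarrow> (('a, 'p) form set \<Rightarrow> real) rel" where
  "canonical_rel n \<alpha> = {(u, v). u \<in> canonical_worlds n \<and> v \<in> canonical_worlds n \<and>
     (\<forall>\<phi>. u (pdl_class n (\<^bold>[\<alpha>\<^bold>] \<phi>)) = 1 \<longrightarrow> v (pdl_class n \<phi>) = 1)}"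

text \<open>Since \<open>R\<close> is given on all programs, the five clauses for \<open>Val\<close> determine it
  on \<open>W\<close> from its values on propositional variables.\<close>

definition nonstandard_model ::
    "nat \<Rightarrow> 'w set \<Rightarrow> (('a, 'p) prog \<Rightarrow> 'w rel) \<Rightarrow> ('w \<Rightarrow> ('a, 'p) form \<Rightarrow> real) \<Rightarrow> bool" where
  "nonstandard_model n W R Val \<longleftrightarrow>
     W \<noteq> {} \<and>
     (\<forall>\<alpha>. R \<alpha> \<subseteq> W \<times> W) \<and>
     (\<forall>w\<in>W. \<forall>p. Val w (PVar p) \<in> Luk n) \<and>
     (\<forall>w\<in>W. Val w \<^bold>0 = 0) \<and>
     (\<forall>w\<in>W. \<forall>\<phi> \<psi>. Val w (\<phi> \<^bold>\<rightarrow> \<psi>) = luk_imp (Val w \<phi>) (Val w \<psi>)) \<and>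
     (\<forall>w\<in>W. \<forall>\<psi>. Val w (\<^bold>\<not> \<psi>) = luk_neg (Val w \<psi>)) \<and>
     (\<forall>w\<in>W. \<forall>\<alpha> \<psi>. Val w (\<^bold>[\<alpha>\<^bold>] \<psi>) = luk_Meet {Val v \<psi> | v. (w, v) \<in> R \<alpha>}) \<and>
     (\<forall>\<alpha> \<beta>. R (Seq \<alpha> \<beta>) = R \<alpha> O R \<beta>) \<and>
     (\<forall>\<alpha> \<beta>. R (Choice \<alpha> \<beta>) = R \<alpha> \<union> R \<beta>) \<and>
     (\<forall>\<psi>. R (Test \<psi>) = {(u, u) | u. u \<in> W \<and> Val u \<psi> = 1}) \<and>
     (\<forall>\<alpha>. (\<forall>w\<in>W. (w, w) \<in> R (Star \<alpha>)) \<and> trans (R (Star \<alpha>)) \<and> R \<alpha> \<subseteq> R (Star \<alpha>)) \<and>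
     (\<forall>w\<in>W. \<forall>\<alpha> \<phi>.
        Val w (\<^bold>[Star \<alpha>\<^bold>] \<phi> \<^bold>\<rightarrow> (\<phi> \<^bold>\<and> \<^bold>[\<alpha>\<^bold>] \<^bold>[Star \<alpha>\<^bold>] \<phi>)) = 1 \<and>
        Val w (\<^bold>[Star \<alpha>\<^bold>] \<phi> \<^bold>\<rightarrow> \<^bold>[Star \<alpha>\<^bold>] \<^bold>[Star \<alpha>\<^bold>] \<phi>) = 1 \<and>
        Val w ((\<phi> \<^bold>\<and> \<^bold>[Star \<alpha>\<^bold>] (odot_power (\<phi> \<^bold>\<rightarrow> \<^bold>[\<alpha>\<^bold>] \<phi>) n)) \<^bold>\<rightarrow> \<^bold>[Star \<alpha>\<^bold>] \<phi>) = 1)"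

end

theory Submission imports Defs "HOL-Analysis.Function_Topology" begin

text \<open>Worlds amount to Lukasiewicz valuations \<open>h\<close> of all formulas with value \<open>1\<close> on \<open>PDL n\<close>.
  Since \<open>Luk n\<close> is finite, compactness of the product space provides a valuation that is \<open>1\<close>
  on a given deductively closed set \<open>T \<supseteq> PDL n\<close> and different from \<open>1\<close> on a given upward
  directed set \<open>D\<close> disjoint from \<open>T\<close>. It is applied to \<open>T = {\<phi>. u ([\<alpha>]\<phi>) = 1}\<close>.

  The modalities commute with \<open>\<phi> \<oplus> \<phi>\<close> and \<open>\<phi> \<odot> \<phi>\<close>, and these two maps generate every
  threshold map \<open>x \<mapsto> (if i/n \<le> x then 1 else 0)\<close> on \<open>Luk n\<close>. Hence relations defined by
  value \<open>1\<close> control all values, which gives the clause for \<open>[\<alpha>]\<phi>\<close> with \<open>D\<close> a single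
  threshold formula. For \<open>\<alpha>;\<beta>\<close> and \<open>(u, w)\<close> in its relation, the intermediate world comes
  from \<open>D = {[\<beta>]\<psi> | w \<psi> \<noteq> 1}\<close>, which is directed because \<open>Luk n\<close> is a chain.\<close>

section \<open>Lukasiewicz valuations and tautologies\<close>

lemma Luk_bounds: "x \<in> Luk n \<Longrightarrow> 0 \<le> x \<and> x \<le> 1"
  by (auto simp: Luk_def divide_le_eq_1)

lemma Luk_le_pred: "x \<in> Luk n \<Longrightarrow> x \<noteq> 1 \<Longrightarrow> n \<ge> 1 \<Longrightarrow> real n * (1 - x) \<ge> 1"
proof -
  assume "x \<in> Luk n" "x \<noteq> 1" "n \<ge> 1"
  then obtain i where i: "x = real i / real n" "i < n"
    by (force simp: Luk_def le_less)
  then have "real i + 1 \<le> real n" by linarith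
  with i show ?thesis by (simp add: field_simps)
qed

lemma Luk_closed:
  assumes "n \<ge> 1"
  shows "0 \<in> Luk n" "1 \<in> Luk n"
    "x \<in> Luk n \<Longrightarrow> luk_neg x \<in> Luk n"
    "x \<in> Luk n \<Longrightarrow> y \<in> Luk n \<Longrightarrow> luk_imp x y \<in> Luk n"
proof -
  show "0 \<in> Luk n" "1 \<in> Luk n"
    using assms by (force simp: Luk_def)+
  show "luk_neg x \<in> Luk n" if x: "x \<in> Luk n"
  proof -
    obtain i where i: "x = real i / real n" "i \<le> n"
      using x by (auto simp: Luk_def)
    then have "luk_neg x = real (n - i) / real n"
      using assms by (simp add: luk_neg_def of_nat_diff field_simps)
    then show ?thesis unfolding Luk_def by (smt (verit) diff_le_self mem_Collect_eq)
  qed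
  show "luk_imp x y \<in> Luk n" if xy: "x \<in> Luk n" "y \<in> Luk n"
  proof -
    obtain i j where i: "x = real i / real n" "i \<le> n" "y = real j / real n" "j \<le> n"
      using xy by (auto simp: Luk_def)
    then have "luk_imp x y = min (real (n - i + j) / real n) (real n / real n)"
      using assms by (simp add: luk_imp_def of_nat_diff diff_divide_distrib add_divide_distrib)
    also have "\<dots> = real (min (n - i + j) n) / real n"
      by (auto simp: min_def divide_right_mono divide_le_cancel)
    finally have "luk_imp x y = real (min (n - i + j) n) / real n" .
    then show ?thesis unfolding Luk_def by (smt (verit) min.cobounded2 mem_Collect_eq)
  qed
qed

definition luk_valuations :: "nat \<Rightarrow> (('a, 'p) form \<Rightarrow> real) set" where
  "luk_valuations n = {h. range h \<subseteq> Luk n \<and> h \<^bold>0 = 0 \<and>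
     (\<forall>\<phi>. h (\<^bold>\<not> \<phi>) = luk_neg (h \<phi>)) \<and>
     (\<forall>\<phi> \<psi>. h (\<phi> \<^bold>\<rightarrow> \<psi>) = luk_imp (h \<phi>) (h \<psi>))}"

lemma valuation_Luk: "h \<in> luk_valuations n \<Longrightarrow> h \<phi> \<in> Luk n"
  by (auto simp: luk_valuations_def)

lemma valuation_simps:
  assumes "h \<in> luk_valuations n"
  shows "h \<^bold>0 = 0" "h (\<^bold>\<not> \<phi>) = 1 - h \<phi>" "h (\<phi> \<^bold>\<rightarrow> \<psi>) = min (1 - h \<phi> + h \<psi>) 1"
    "0 \<le> h \<phi>" "h \<phi> \<le> 1"
  using assms Luk_bounds valuation_Luk[OF assms]
  by (auto simp: luk_valuations_def luk_neg_def luk_imp_def)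

lemma valuation_connectives:
  assumes h: "h \<in> luk_valuations n"
  shows "h (\<phi> \<^bold>\<or> \<psi>) = max (h \<phi>) (h \<psi>)"
    and "h (\<phi> \<^bold>\<and> \<psi>) = min (h \<phi>) (h \<psi>)"
    and "h (\<phi> \<^bold>\<leftrightarrow> \<psi>) = 1 \<longleftrightarrow> h \<phi> = h \<psi>"
proof -
  have "0 \<le> h \<phi>" "h \<phi> \<le> 1" "0 \<le> h \<psi>" "h \<psi> \<le> 1"
    by (rule valuation_simps[OF h])+
  then show "h (\<phi> \<^bold>\<or> \<psi>) = max (h \<phi>) (h \<psi>)"
    and "h (\<phi> \<^bold>\<and> \<psi>) = min (h \<phi>) (h \<psi>)"
    and "h (\<phi> \<^bold>\<leftrightarrow> \<psi>) = 1 \<longleftrightarrow> h \<phi> = h \<psi>"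
    by (auto simp: valuation_simps(1-3)[OF h] min_def max_def)
qed

lemma valuation_Imp: "h \<in> luk_valuations n \<Longrightarrow> h (\<phi> \<^bold>\<rightarrow> \<psi>) = 1 \<longleftrightarrow> h \<phi> \<le> h \<psi>"
  by (auto simp: valuation_simps)

lemma valuation_odot_power:
  assumes h: "h \<in> luk_valuations n"
  shows "h (odot_power \<phi> k) = max 0 (1 - real k * (1 - h \<phi>))"
proof (induction \<phi> k rule: odot_power.induct)
  case (3 \<phi> k)
  have "real (Suc k) * (1 - h \<phi>) \<ge> 0"
    using valuation_simps(5)[OF h] by simp
  then show ?case
    using valuation_simps(4,5)[OF h, of \<phi>] 3
    by (simp add: valuation_simps(1-3)[OF h] algebra_simps max_def min_def)
qed (use valuation_simps[OF h] in \<open>auto simp: max_def\<close>)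

lemma valuation_odot_power_n:
  assumes "h \<in> luk_valuations n" "n \<ge> 1"
  shows "h (odot_power \<phi> n) = (if h \<phi> = 1 then 1 else 0)"
  using Luk_le_pred[OF valuation_Luk[OF assms(1)]] assms
  by (auto simp: valuation_odot_power)

fun lform_of_form :: "(('a, 'p) form \<Rightarrow> 'p) \<Rightarrow> ('a, 'p) form \<Rightarrow> 'p lform" where
  "lform_of_form f \<^bold>0 = LFalsum"
| "lform_of_form f (\<^bold>\<not> \<phi>) = LNeg (lform_of_form f \<phi>)"
| "lform_of_form f (\<phi> \<^bold>\<rightarrow> \<psi>) = LImp (lform_of_form f \<phi>) (lform_of_form f \<psi>)"
| "lform_of_form f \<phi> = LVar (f \<phi>)"

fun prop_atoms :: "('a, 'p) form \<Rightarrow> ('a, 'p) form set" where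
  "prop_atoms \<^bold>0 = {}"
| "prop_atoms (\<^bold>\<not> \<phi>) = prop_atoms \<phi>"
| "prop_atoms (\<phi> \<^bold>\<rightarrow> \<psi>) = prop_atoms \<phi> \<union> prop_atoms \<psi>"
| "prop_atoms \<phi> = {\<phi>}"

lemma finite_prop_atoms: "finite (prop_atoms \<phi>)"
  by (induction \<phi> rule: prop_atoms.induct) auto

lemma subst_lform_of_form:
  "\<forall>\<chi> \<in> prop_atoms \<phi>. \<sigma> (f \<chi>) = \<chi> \<Longrightarrow>
    subst_form \<sigma> (form_of_lform (lform_of_form f \<phi>)) = \<phi>"
  by (induction f \<phi> rule: lform_of_form.induct) simp_all

lemma luk_eval_valuation:
  assumes "n \<ge> 1" "\<And>p. v p \<in> Luk n"
  shows "(\<lambda>\<phi>. luk_eval v (lform_of_form f \<phi>)) \<in> luk_valuations n"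
proof -
  have "luk_eval v \<tau> \<in> Luk n" for \<tau>
    using assms Luk_closed by (induction \<tau>) auto
  then show ?thesis by (auto simp: luk_valuations_def)
qed

lemma PDL_tautology:
  fixes \<phi> :: "('a, 'p) form"
  assumes "n \<ge> 1" "infinite (UNIV :: 'p set)"
    and valid: "\<And>h. h \<in> luk_valuations n \<Longrightarrow> h \<phi> = 1"
  shows "\<phi> \<in> PDL n"
proof -
  obtain P :: "'p set" where "finite P" "card P = card (prop_atoms \<phi>)"
    using infinite_arbitrarily_large[OF assms(2)] by metis
  then obtain f where f: "bij_betw f (prop_atoms \<phi>) P"
    using finite_same_card_bij[OF finite_prop_atoms] by metis
  have "luk_tautology n (lform_of_form f \<phi>)"
    using valid luk_eval_valuation[OF assms(1)] by (auto simp: luk_tautology_def)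
  then have "subst_form (inv_into (prop_atoms \<phi>) f) (form_of_lform (lform_of_form f \<phi>)) \<in> PDL n"
    by (intro PDL.subst PDL.taut)
  moreover have "inv_into (prop_atoms \<phi>) f (f \<chi>) = \<chi>" if "\<chi> \<in> prop_atoms \<phi>" for \<chi>
    using f that by (simp add: bij_betw_def)
  ultimately show ?thesis by (simp add: subst_lform_of_form)
qed

section \<open>Extension by compactness\<close>

definition pdl_theory :: "nat \<Rightarrow> ('a, 'p) form set \<Rightarrow> bool" where
  "pdl_theory n T \<longleftrightarrow> PDL n \<subseteq> T \<and> (\<forall>\<phi> \<psi>. \<phi> \<in> T \<longrightarrow> \<phi> \<^bold>\<rightarrow> \<psi> \<in> T \<longrightarrow> \<psi> \<in> T)"

lemma pdl_theory_PDL: "pdl_theory n (PDL n)"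
  by (auto simp: pdl_theory_def intro: PDL.mp)

text \<open>In \<open>Luk n\<close>, discharging a hypothesis \<open>n\<close> times turns semantic consequence
  into validity: a hypothesis of value at most \<open>1 - 1/n\<close> contributes nothing below \<open>1\<close>.\<close>

lemma pdl_theory_finite_entailment:
  fixes T :: "('a, 'p) form set"
  assumes n: "n \<ge> 1" "infinite (UNIV :: 'p set)" and T: "pdl_theory n T"
    and "finite S" "S \<subseteq> T"
    and "\<And>h. h \<in> luk_valuations n \<Longrightarrow> (\<And>\<psi>. \<psi> \<in> S \<Longrightarrow> h \<psi> = 1) \<Longrightarrow> h \<phi> = 1"
  shows "\<phi> \<in> T"
  using assms(4-)
proof (induction S arbitrary: \<phi> rule: finite_induct)
  case empty
  then show ?case using T PDL_tautology[OF n] by (auto simp: pdl_theory_def)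
next
  case (insert t S)
  let ?d = "\<lambda>k. (((\<^bold>\<rightarrow>) t) ^^ k) \<phi>"
  have "?d n \<in> T"
  proof (rule insert.IH)
    fix h :: "('a, 'p) form \<Rightarrow> real"
    assume h: "h \<in> luk_valuations n" and S: "\<And>\<psi>. \<psi> \<in> S \<Longrightarrow> h \<psi> = 1"
    have d: "h (?d k) = min 1 (real k * (1 - h t) + h \<phi>)" for k
    proof (induction k)
      case 0
      then show ?case using valuation_simps(5)[OF h, of \<phi>] by simp
    next
      case (Suc k)
      have "h (?d (Suc k)) = min (1 - h t + h (?d k)) 1"
        by (simp add: valuation_simps(3)[OF h])
      moreover have "real (Suc k) * (1 - h t) = (1 - h t) + real k * (1 - h t)"
        by (simp add: algebra_simps)
      ultimately show ?case
        using Suc.IH valuation_simps(5)[OF h, of t] by linarith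
    qed
    show "h (?d n) = 1"
    proof (cases "h t = 1")
      case True
      then have "h \<phi> = 1" using insert.prems(2)[OF h] S by auto
      then show ?thesis using d True by simp
    next
      case False
      then have "real n * (1 - h t) \<ge> 1"
        using Luk_le_pred[OF valuation_Luk[OF h]] n(1) by blast
      then show ?thesis using d valuation_simps(4)[OF h, of \<phi>] by simp
    qed
  qed (use insert.prems(1) in auto)
  moreover have "\<psi> \<in> T" if "t \<^bold>\<rightarrow> \<psi> \<in> T" for \<psi>
    using T insert.prems(1) that unfolding pdl_theory_def by blast
  then have "?d k \<in> T \<Longrightarrow> \<phi> \<in> T" for k by (induction k) simp_all
  ultimately show ?case by blast
qed

lemma compact_luk_valuations: "compact (luk_valuations n :: (('a, 'p) form \<Rightarrow> real) set)"
proof -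
  have "finite (Luk n)" by (simp add: Luk_def)
  then have "compactin (product_topology (\<lambda>_. euclidean) UNIV)
      (PiE (UNIV :: ('a, 'p) form set) (\<lambda>_. Luk n))"
    by (auto simp: compactin_PiE finite_imp_compact)
  then have K: "compact (PiE (UNIV :: ('a, 'p) form set) (\<lambda>_. Luk n))"
    by (simp add: euclidean_product_topology)
  have "closed {h :: ('a, 'p) form \<Rightarrow> real. h \<^bold>0 = 0 \<and>
     (\<forall>\<phi>. h (\<^bold>\<not> \<phi>) = luk_neg (h \<phi>)) \<and>
     (\<forall>\<phi> \<psi>. h (\<phi> \<^bold>\<rightarrow> \<psi>) = luk_imp (h \<phi>) (h \<psi>))}"
    unfolding luk_neg_def luk_imp_def
    by (intro closed_Collect_conj closed_Collect_all closed_Collect_eq continuous_intros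
        continuous_on_product_coordinates)
  from compact_Int_closed[OF K this] show ?thesis
    by (rule back_subst[of compact]) (auto simp: luk_valuations_def PiE_UNIV_domain)
qed

text \<open>Pairs \<open>(\<phi>, True)\<close> demand value \<open>1\<close> and pairs \<open>(\<phi>, False)\<close> a value other than \<open>1\<close>.\<close>

lemma valuation_compactness:
  fixes C :: "(('a, 'p) form \<times> bool) set"
  assumes n: "n \<ge> 1"
    and fin: "\<And>F. finite F \<Longrightarrow> F \<subseteq> C \<Longrightarrow>
      \<exists>h \<in> luk_valuations n. \<forall>(\<phi>, b) \<in> F. (h \<phi> = 1) = b"
  shows "\<exists>h \<in> luk_valuations n. \<forall>(\<phi>, b) \<in> C. (h \<phi> = 1) = b"
proof -
  let ?X = "\<lambda>(\<phi>, b). if b then {h :: ('a, 'p) form \<Rightarrow> real. h \<phi> = 1}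
    else {h. h \<phi> \<le> 1 - 1 / real n}"
  have X: "h \<in> ?X c \<longleftrightarrow> (case c of (\<phi>, b) \<Rightarrow> (h \<phi> = 1) = b)"
    if "h \<in> luk_valuations n" for h c
    using Luk_le_pred[OF valuation_Luk[OF that], of "fst c"] n
    by (cases c) (auto simp: field_simps)
  have "luk_valuations n \<inter> \<Inter>(?X ` C) \<noteq> {}"
  proof (rule compact_imp_fip_image[OF compact_luk_valuations])
    show "closed (?X c)" for c
      by (cases c) (auto intro!: closed_Collect_eq closed_Collect_le continuous_intros
          continuous_on_product_coordinates)
    fix F assume "finite F" "F \<subseteq> C"
    from fin[OF this] obtain h where "h \<in> luk_valuations n" "\<forall>(\<phi>, b) \<in> F. (h \<phi> = 1) = b"
      by blast
    then have "h \<in> luk_valuations n \<inter> \<Inter>(?X ` F)" by (simp only: Int_iff INT_iff X)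
    then show "luk_valuations n \<inter> \<Inter>(?X ` F) \<noteq> {}" by blast
  qed
  then obtain h where "h \<in> luk_valuations n" "\<And>c. c \<in> C \<Longrightarrow> h \<in> ?X c" by blast
  then show ?thesis by (intro bexI[of _ h] ballI) (simp_all only: X)
qed

lemma pdl_theory_extension:
  fixes T D :: "('a, 'p) form set"
  assumes n: "n \<ge> 1" "infinite (UNIV :: 'p set)" and T: "pdl_theory n T"
    and D: "D \<noteq> {}" "D \<inter> T = {}"
    and directed: "\<And>\<phi> \<psi>. \<phi> \<in> D \<Longrightarrow> \<psi> \<in> D \<Longrightarrow> \<exists>\<chi> \<in> D. \<phi> \<^bold>\<rightarrow> \<chi> \<in> T \<and> \<psi> \<^bold>\<rightarrow> \<chi> \<in> T"
  shows "\<exists>h \<in> luk_valuations n. (\<forall>\<phi> \<in> T. h \<phi> = 1) \<and> (\<forall>\<phi> \<in> D. h \<phi> \<noteq> 1)"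
proof -
  have upper: "\<exists>\<chi> \<in> D. \<forall>\<phi> \<in> F. \<phi> \<^bold>\<rightarrow> \<chi> \<in> T" if "finite F" "F \<subseteq> D" for F
    using that
  proof (induction F rule: finite_induct)
    case empty
    then show ?case using D by auto
  next
    case (insert \<psi> F)
    then obtain \<chi> where \<chi>: "\<chi> \<in> D" "\<forall>\<phi> \<in> F. \<phi> \<^bold>\<rightarrow> \<chi> \<in> T" by auto
    from directed[of \<psi> \<chi>] \<chi>(1) insert.prems obtain \<chi>' where
      \<chi>': "\<chi>' \<in> D" "\<psi> \<^bold>\<rightarrow> \<chi>' \<in> T" "\<chi> \<^bold>\<rightarrow> \<chi>' \<in> T" by auto
    have "\<phi> \<^bold>\<rightarrow> \<chi>' \<in> T" if "\<phi> \<in> F" for \<phi>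
    proof (rule pdl_theory_finite_entailment[OF n T, of "{\<phi> \<^bold>\<rightarrow> \<chi>, \<chi> \<^bold>\<rightarrow> \<chi>'}"])
      show "{\<phi> \<^bold>\<rightarrow> \<chi>, \<chi> \<^bold>\<rightarrow> \<chi>'} \<subseteq> T"
        using \<chi> \<chi>' that by simp
      show "h (\<phi> \<^bold>\<rightarrow> \<chi>') = 1" if h: "h \<in> luk_valuations n"
        and one: "\<And>\<psi>. \<psi> \<in> {\<phi> \<^bold>\<rightarrow> \<chi>, \<chi> \<^bold>\<rightarrow> \<chi>'} \<Longrightarrow> h \<psi> = 1" for h
        using one[of "\<phi> \<^bold>\<rightarrow> \<chi>"] one[of "\<chi> \<^bold>\<rightarrow> \<chi>'"]
        by (simp add: valuation_simps(3)[OF h])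
    qed simp
    with \<chi>' show ?case by auto
  qed
  have "\<exists>h \<in> luk_valuations n. \<forall>(\<phi>, b) \<in> T \<times> {True} \<union> D \<times> {False}. (h \<phi> = 1) = b"
  proof (rule valuation_compactness[OF n(1)])
    fix F :: "(('a, 'p) form \<times> bool) set"
    assume F: "finite F" "F \<subseteq> T \<times> {True} \<union> D \<times> {False}"
    let ?S = "{\<phi>. (\<phi>, True) \<in> F}" and ?E = "{\<phi>. (\<phi>, False) \<in> F}"
    have fin: "finite ?S" "finite ?E"
      using finite_imageI[OF F(1), of fst] by (force elim: finite_subset[rotated])+
    from upper[OF fin(2)] F(2) obtain \<chi> where \<chi>: "\<chi> \<in> D" "\<And>\<phi>. \<phi> \<in> ?E \<Longrightarrow> \<phi> \<^bold>\<rightarrow> \<chi> \<in> T"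
      by auto
    have "\<exists>h \<in> luk_valuations n. (\<forall>\<psi> \<in> ?S \<union> (\<lambda>\<phi>. \<phi> \<^bold>\<rightarrow> \<chi>) ` ?E. h \<psi> = 1) \<and> h \<chi> \<noteq> 1"
    proof (rule ccontr)
      assume "\<not> ?thesis"
      then have "\<chi> \<in> T"
        using F \<chi> fin
        by (intro pdl_theory_finite_entailment[OF n T, of "?S \<union> (\<lambda>\<phi>. \<phi> \<^bold>\<rightarrow> \<chi>) ` ?E"]) auto
      with \<chi> D show False by auto
    qed
    then obtain h where h: "h \<in> luk_valuations n" "\<And>\<psi>. \<psi> \<in> ?S \<Longrightarrow> h \<psi> = 1"
      "\<And>\<psi>. \<psi> \<in> ?E \<Longrightarrow> h (\<psi> \<^bold>\<rightarrow> \<chi>) = 1" "h \<chi> \<noteq> 1" by auto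
    have "h \<psi> \<noteq> 1" if "\<psi> \<in> ?E" for \<psi>
      using h(3)[OF that] h(4) valuation_simps(3-5)[OF h(1)] by (smt (verit))
    with h show "\<exists>h \<in> luk_valuations n. \<forall>(\<phi>, b) \<in> F. (h \<phi> = 1) = b"
      by (intro bexI[of _ h]) (auto, metis (full_types))
  qed
  then obtain h where h: "h \<in> luk_valuations n"
    and C: "\<And>c. c \<in> T \<times> {True} \<union> D \<times> {False} \<Longrightarrow> case c of (\<phi>, b) \<Rightarrow> (h \<phi> = 1) = b"
    by blast
  have "h \<phi> = 1" if "\<phi> \<in> T" for \<phi> using C[of "(\<phi>, True)"] that by simp
  moreover have "h \<phi> \<noteq> 1" if "\<phi> \<in> D" for \<phi> using C[of "(\<phi>, False)"] that by simp
  ultimately show ?thesis using h by blast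
qed

section \<open>Threshold formulas\<close>

fun threshold :: "nat \<Rightarrow> nat \<Rightarrow> ('a, 'p) form \<Rightarrow> ('a, 'p) form" where
  "threshold 0 k \<phi> = \<phi>"
| "threshold (Suc m) k \<phi> =
    (if k < 2 ^ m then threshold m k (\<phi> \<^bold>\<oplus> \<phi>) else threshold m (k - 2 ^ m) (\<phi> \<^bold>\<odot> \<phi>))"

definition doubling :: "nat \<Rightarrow> (('a, 'p) form \<Rightarrow> real) \<Rightarrow> bool" where
  "doubling n h \<longleftrightarrow> (\<forall>\<phi>. h \<phi> \<in> Luk n \<and> h (\<phi> \<^bold>\<oplus> \<phi>) = min 1 (2 * h \<phi>) \<and>
     h (\<phi> \<^bold>\<odot> \<phi>) = max 0 (2 * h \<phi> - 1))"

lemma doubling_valuation: "h \<in> luk_valuations n \<Longrightarrow> doubling n h"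
  using valuation_simps[of h n]
  by (auto simp: doubling_def valuation_Luk)

text \<open>The binary digits of \<open>k\<close> steer the dynamics of \<open>x \<oplus> x\<close> and \<open>x \<odot> x\<close>, so that
  the result grows from \<open>0\<close> to \<open>1\<close> exactly on \<open>[k / 2 ^ m, (k + 1) / 2 ^ m]\<close>.\<close>

lemma doubling_threshold:
  assumes h: "doubling n h" and "k < 2 ^ m"
  shows "h (threshold m k \<phi>) = max 0 (min 1 (2 ^ m * h \<phi> - real k))"
  using assms(2)
proof (induction m arbitrary: k \<phi>)
  case 0
  then show ?case using h Luk_bounds[of "h \<phi>" n] by (auto simp: doubling_def)
next
  case (Suc m)
  have hb: "0 \<le> h \<phi>" "h \<phi> \<le> 1" using h Luk_bounds[of "h \<phi>" n] by (auto simp: doubling_def)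
  show ?case
  proof (cases "k < 2 ^ m")
    case True
    then have k: "real k + 1 \<le> 2 ^ m"
      by (metis Suc_leI of_nat_Suc of_nat_le_iff of_nat_numeral of_nat_power add.commute)
    have e: "h (threshold (Suc m) k \<phi>) = max 0 (min 1 (2 ^ m * min 1 (2 * h \<phi>) - real k))"
      using Suc.IH[OF True] h True by (simp add: doubling_def)
    show ?thesis
    proof (cases "2 * h \<phi> \<le> 1")
      case False
      then have "2 ^ m * (2 * h \<phi>) \<ge> 2 ^ m * 1" by (intro mult_left_mono) auto
      moreover have "h (threshold (Suc m) k \<phi>) = 1" using e False k by linarith
      ultimately show ?thesis using k unfolding power_Suc by linarith
    qed (simp only: e, simp add: algebra_simps)
  next
    case False
    then have k: "k - 2 ^ m < 2 ^ m" "real (k - 2 ^ m) = real k - 2 ^ m" "real k \<ge> 2 ^ m"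
      using Suc.prems by (auto simp: of_nat_diff not_less)
    have e: "h (threshold (Suc m) k \<phi>) =
        max 0 (min 1 (2 ^ m * max 0 (2 * h \<phi> - 1) - (real k - 2 ^ m)))"
      using Suc.IH[OF k(1)] h False k(2) by (simp add: doubling_def)
    show ?thesis
    proof (cases "2 * h \<phi> \<ge> 1")
      case False
      then have "2 ^ m * (2 * h \<phi>) \<le> 2 ^ m * 1" by (intro mult_left_mono) auto
      moreover have "h (threshold (Suc m) k \<phi>) = 0" using e False k(3) by (simp add: max_def)
      ultimately show ?thesis using k(3) unfolding power_Suc by linarith
    qed (simp only: e, simp add: algebra_simps)
  qed
qed

lemma threshold_exists:
  assumes i: "1 \<le> i" "i \<le> n"
  obtains m k where "\<And>h \<phi>. doubling n h \<Longrightarrow>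
    h (threshold m k \<phi>) = (if real i / real n \<le> h \<phi> then 1 else 0)"
proof -
  let ?m = "2 * n" and ?k = "nat \<lceil>(real i - 1) * 2 ^ (2 * n) / real n\<rceil>"
  have n: "real n \<ge> 1" using i by auto
  have pw: "2 * real n \<le> 2 ^ ?m"
    by (metis less_exp less_imp_le of_nat_le_iff of_nat_mult of_nat_numeral of_nat_power)
  have lo: "(real i - 1) * 2 ^ ?m / real n \<le> real ?k" using i n by (simp add: real_nat_ceiling_ge)
  have "real ?k \<le> (real i - 1) * 2 ^ ?m / real n + 1" using i n by simp
  moreover have "2 \<le> 2 ^ ?m / real n" using pw n by (simp add: field_simps)
  ultimately have hi: "real ?k + 1 \<le> real i * 2 ^ ?m / real n"
    by (simp add: algebra_simps diff_divide_distrib)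
  have "real i * 2 ^ ?m / real n \<le> 2 ^ ?m" using i n by (simp add: field_simps)
  with hi have "real ?k < 2 ^ ?m" by linarith
  then have k: "?k < 2 ^ ?m"
    by (metis of_nat_less_iff of_nat_numeral of_nat_power)
  show thesis
  proof (rule that)
    fix h :: "('a, 'b) form \<Rightarrow> real" and \<phi>
    assume h: "doubling n h"
    obtain j where j: "h \<phi> = real j / real n" using h by (auto simp: doubling_def Luk_def)
    show "h (threshold ?m ?k \<phi>) = (if real i / real n \<le> h \<phi> then 1 else 0)"
    proof (cases "i \<le> j")
      case True
      then have "real i * 2 ^ ?m / real n \<le> real j * 2 ^ ?m / real n"
        using n by (simp add: divide_right_mono)
      then have "1 \<le> 2 ^ ?m * h \<phi> - real ?k" using hi j by (simp add: mult.commute)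
      then show ?thesis using True j n by (simp add: doubling_threshold[OF h k] divide_right_mono)
    next
      case False
      then have "real j * 2 ^ ?m / real n \<le> (real i - 1) * 2 ^ ?m / real n"
        using n by (intro divide_right_mono mult_right_mono) auto
      then have "2 ^ ?m * h \<phi> - real ?k \<le> 0" using lo j by (simp add: mult.commute)
      then show ?thesis using False j n by (simp add: doubling_threshold[OF h k] divide_le_cancel)
    qed
  qed
qed

lemma doubling_le:
  assumes "doubling n g" "doubling n h" "\<And>\<phi>. g \<phi> = 1 \<Longrightarrow> h \<phi> = 1"
  shows "g \<phi> \<le> h \<phi>"
proof -
  obtain i where i: "g \<phi> = real i / real n" "i \<le> n" using assms(1) by (auto simp: doubling_def Luk_def)
  show ?thesis
  proof (cases "i = 0")
    case True
    then show ?thesis using i assms(2) Luk_bounds by (auto simp: doubling_def)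
  next
    case False
    then obtain m k where thr: "\<And>h \<phi>. doubling n h \<Longrightarrow>
        h (threshold m k \<phi> :: ('a, 'b) form) = (if real i / real n \<le> h \<phi> then 1 else 0)"
      using threshold_exists[of i n] i by (metis One_nat_def Suc_leI neq0_conv)
    have "g (threshold m k \<phi>) = 1" using thr[OF assms(1)] i by simp
    then have "h (threshold m k \<phi>) = 1" by (rule assms(3))
    then show ?thesis using thr[OF assms(2), of \<phi>] i by (simp split: if_splits)
  qed
qed

section \<open>A one-world model\<close>

text \<open>The standard model with a single world \<open>w\<close> and all atomic programs interpreted as
  \<open>{(w, w)}\<close>: a program runs iff all the tests on some path through it succeed.\<close>

primrec loop_val :: "('p \<Rightarrow> real) \<Rightarrow> ('a, 'p) form \<Rightarrow> real"
  and loop_runs :: "('p \<Rightarrow> real) \<Rightarrow> ('a, 'p) prog \<Rightarrow> bool" where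
  "loop_val v (PVar p) = v p"
| "loop_val v \<^bold>0 = 0"
| "loop_val v (\<^bold>\<not> \<phi>) = luk_neg (loop_val v \<phi>)"
| "loop_val v (\<phi> \<^bold>\<rightarrow> \<psi>) = luk_imp (loop_val v \<phi>) (loop_val v \<psi>)"
| "loop_val v (\<^bold>[\<alpha>\<^bold>] \<phi>) = (if loop_runs v \<alpha> then loop_val v \<phi> else 1)"
| "loop_runs v (Atom a) \<longleftrightarrow> True"
| "loop_runs v (Test \<phi>) \<longleftrightarrow> loop_val v \<phi> = 1"
| "loop_runs v (Seq \<alpha> \<beta>) \<longleftrightarrow> loop_runs v \<alpha> \<and> loop_runs v \<beta>"
| "loop_runs v (Choice \<alpha> \<beta>) \<longleftrightarrow> loop_runs v \<alpha> \<or> loop_runs v \<beta>"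
| "loop_runs v (Star \<alpha>) \<longleftrightarrow> True"

lemma loop_val_Luk:
  fixes \<phi> :: "('a, 'p) form" and \<alpha> :: "('a, 'p) prog"
  assumes "n \<ge> 1" "\<forall>p. v p \<in> Luk n"
  shows "loop_val v \<phi> \<in> Luk n" "True"
  using assms Luk_closed by (induction \<phi> and \<alpha>) auto

lemma loop_val_valuation:
  assumes "n \<ge> 1" "\<forall>p. v p \<in> Luk n"
  shows "loop_val v \<in> luk_valuations n"
  using loop_val_Luk(1)[OF assms] by (auto simp: luk_valuations_def)

lemma loop_val_subst:
  fixes \<phi> :: "('a, 'p) form" and \<alpha> :: "('a, 'p) prog"
  shows "loop_val v (subst_form \<sigma> \<phi>) = loop_val (\<lambda>p. loop_val v (\<sigma> p)) \<phi>"
    and "loop_runs v (subst_prog \<sigma> \<alpha>) = loop_runs (\<lambda>p. loop_val v (\<sigma> p)) \<alpha>"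
  by (induction \<phi> and \<alpha>) auto

lemma loop_val_form_of_lform: "loop_val v (form_of_lform \<tau>) = luk_eval v \<tau>"
  by (induction \<tau>) auto

lemma PDL_loop_sound:
  assumes "n \<ge> 1" "\<phi> \<in> PDL n" "\<forall>p. v p \<in> Luk n"
  shows "loop_val v \<phi> = 1"
  using assms(2,3)
proof (induction arbitrary: v rule: PDL.induct)
  case (mp \<phi> \<psi>)
  have "loop_val v \<phi> = 1" "loop_val v (\<phi> \<^bold>\<rightarrow> \<psi>) = 1"
    using mp.IH(1)[OF mp.prems] mp.IH(2)[OF mp.prems] by blast+
  moreover have "loop_val v \<psi> \<le> 1"
    using Luk_bounds loop_val_Luk(1)[OF assms(1) mp.prems] by blast
  ultimately show ?case by (simp add: luk_imp_def min_def split: if_splits)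
next
  case (subst \<phi> \<sigma>)
  have "loop_val (\<lambda>p. loop_val v (\<sigma> p)) \<phi> = 1"
    by (rule subst.IH) (simp add: loop_val_Luk(1)[OF assms(1) subst.prems])
  then show ?case by (simp add: loop_val_subst)
next
  case (taut \<tau>)
  then show ?case by (simp add: luk_tautology_def loop_val_form_of_lform)
next
  case (test q p)
  note h = loop_val_valuation[OF assms(1) test.prems]
  show ?case unfolding valuation_connectives[OF h]
    using Luk_bounds[OF test.prems[rule_format, of p]]
    by (simp add: valuation_odot_power_n[OF h assms(1)] luk_neg_def max_def)
next
  case (star_ind p \<alpha>)
  note h = loop_val_valuation[OF assms(1) star_ind.prems]
  show ?case unfolding valuation_Imp[OF h] valuation_connectives[OF h] by simp
next
  case (K \<alpha> p q)
  show ?case by (simp add: luk_imp_def)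
next
  case (box_oplus \<alpha> p)
  note h = loop_val_valuation[OF assms(1) box_oplus.prems]
  show ?case unfolding valuation_connectives[OF h] by (simp add: luk_imp_def luk_neg_def)
next
  case (box_odot \<alpha> p)
  note h = loop_val_valuation[OF assms(1) box_odot.prems]
  show ?case unfolding valuation_connectives[OF h] by (simp add: luk_imp_def luk_neg_def)
next
  case (choice \<alpha> \<beta> p)
  note h = loop_val_valuation[OF assms(1) choice.prems]
  show ?case unfolding valuation_connectives[OF h]
    using Luk_bounds[OF choice.prems[rule_format, of p]] by simp
next
  case (seq \<alpha> \<beta> p)
  note h = loop_val_valuation[OF assms(1) seq.prems]
  show ?case unfolding valuation_connectives[OF h] by simp
next
  case (star_unfold \<alpha> p)
  note h = loop_val_valuation[OF assms(1) star_unfold.prems]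
  show ?case unfolding valuation_connectives[OF h]
    using Luk_bounds[OF star_unfold.prems[rule_format, of p]] by simp
qed (simp_all add: luk_imp_def)

section \<open>Instances of the axioms\<close>

lemma finite_variables:
  fixes \<phi> :: "('a, 'p) form" and \<alpha> :: "('a, 'p) prog"
  shows "finite (set2_form \<phi>)" "finite (set2_prog \<alpha>)"
  by (induction \<phi> and \<alpha>) auto

lemma subst_ident:
  fixes \<phi> :: "('a, 'p) form" and \<alpha> :: "('a, 'p) prog"
  shows "\<forall>p \<in> set2_form \<phi>. \<sigma> p = PVar p \<Longrightarrow> subst_form \<sigma> \<phi> = \<phi>"
    and "\<forall>p \<in> set2_prog \<alpha>. \<sigma> p = PVar p \<Longrightarrow> subst_prog \<sigma> \<alpha> = \<alpha>"
  by (induction \<phi> and \<alpha>) auto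

lemma subst_odot_power: "subst_form \<sigma> (odot_power \<phi> k) = odot_power (subst_form \<sigma> \<phi>) k"
  by (induction \<phi> k rule: odot_power.induct) auto

text \<open>Substituting in \<open>\<^bold>[\<alpha>\<^bold>] p\<close> also changes \<open>\<alpha>\<close>, so the axioms are instantiated at
  variables that do not occur in \<open>\<alpha>\<close>; this is where \<open>Prop\<close> has to be infinite.\<close>

lemma fresh_variables:
  fixes \<alpha> :: "('a, 'p) prog"
  assumes "infinite (UNIV :: 'p set)"
  obtains p q where "p \<noteq> q" "subst_prog (PVar(p := \<phi>, q := \<psi>)) \<alpha> = \<alpha>"
proof -
  obtain p where p: "p \<notin> set2_prog \<alpha>"
    using ex_new_if_finite[OF assms finite_variables(2)] by metis
  obtain q where q: "q \<notin> insert p (set2_prog \<alpha>)"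
    using ex_new_if_finite[OF assms] finite_variables(2) by (metis finite_insert)
  show thesis
    by (rule that[of p q]) (use p q in \<open>auto intro!: subst_ident(2)\<close>)
qed

lemma PDL_axiom_instances:
  fixes \<alpha> \<beta> :: "('a, 'p) prog" and \<phi> \<psi> :: "('a, 'p) form"
  assumes inf: "infinite (UNIV :: 'p set)"
  shows PDL_K: "\<^bold>[\<alpha>\<^bold>] (\<phi> \<^bold>\<rightarrow> \<psi>) \<^bold>\<rightarrow> (\<^bold>[\<alpha>\<^bold>] \<phi> \<^bold>\<rightarrow> \<^bold>[\<alpha>\<^bold>] \<psi>) \<in> PDL n"
    and PDL_box_oplus: "\<^bold>[\<alpha>\<^bold>] (\<phi> \<^bold>\<oplus> \<phi>) \<^bold>\<leftrightarrow> (\<^bold>[\<alpha>\<^bold>] \<phi> \<^bold>\<oplus> \<^bold>[\<alpha>\<^bold>] \<phi>) \<in> PDL n"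
    and PDL_box_odot: "\<^bold>[\<alpha>\<^bold>] (\<phi> \<^bold>\<odot> \<phi>) \<^bold>\<leftrightarrow> (\<^bold>[\<alpha>\<^bold>] \<phi> \<^bold>\<odot> \<^bold>[\<alpha>\<^bold>] \<phi>) \<in> PDL n"
    and PDL_choice: "\<^bold>[Choice \<alpha> \<beta>\<^bold>] \<phi> \<^bold>\<leftrightarrow> (\<^bold>[\<alpha>\<^bold>] \<phi> \<^bold>\<and> \<^bold>[\<beta>\<^bold>] \<phi>) \<in> PDL n"
    and PDL_seq: "\<^bold>[Seq \<alpha> \<beta>\<^bold>] \<phi> \<^bold>\<leftrightarrow> \<^bold>[\<alpha>\<^bold>] \<^bold>[\<beta>\<^bold>] \<phi> \<in> PDL n"
    and PDL_test: "\<^bold>[Test \<psi>\<^bold>] \<phi> \<^bold>\<leftrightarrow> (\<^bold>\<not> (odot_power \<psi> n) \<^bold>\<or> \<phi>) \<in> PDL n"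
    and PDL_star_unfold: "\<^bold>[Star \<alpha>\<^bold>] \<phi> \<^bold>\<leftrightarrow> (\<phi> \<^bold>\<and> \<^bold>[\<alpha>\<^bold>] \<^bold>[Star \<alpha>\<^bold>] \<phi>) \<in> PDL n"
    and PDL_star_trans: "\<^bold>[Star \<alpha>\<^bold>] \<phi> \<^bold>\<rightarrow> \<^bold>[Star \<alpha>\<^bold>] \<^bold>[Star \<alpha>\<^bold>] \<phi> \<in> PDL n"
    and PDL_star_ind: "(\<phi> \<^bold>\<and> \<^bold>[Star \<alpha>\<^bold>] (odot_power (\<phi> \<^bold>\<rightarrow> \<^bold>[\<alpha>\<^bold>] \<phi>) n))
      \<^bold>\<rightarrow> \<^bold>[Star \<alpha>\<^bold>] \<phi> \<in> PDL n"
proof -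
  obtain p q where pq: "p \<noteq> q"
    and "subst_prog (PVar(p := \<phi>, q := \<psi>)) (Choice \<alpha> \<beta>) = Choice \<alpha> \<beta>"
    using fresh_variables[OF inf] by metis
  then have s: "subst_prog (PVar(p := \<phi>, q := \<psi>)) \<alpha> = \<alpha>"
    "subst_prog (PVar(p := \<phi>, q := \<psi>)) \<beta> = \<beta>" by auto
  note inst = PDL.subst[where \<sigma> = "PVar(p := \<phi>, q := \<psi>)"]
  note simps = s pq subst_odot_power
  show "\<^bold>[\<alpha>\<^bold>] (\<phi> \<^bold>\<rightarrow> \<psi>) \<^bold>\<rightarrow> (\<^bold>[\<alpha>\<^bold>] \<phi> \<^bold>\<rightarrow> \<^bold>[\<alpha>\<^bold>] \<psi>) \<in> PDL n"
    using inst[OF PDL.K[where \<alpha> = \<alpha> and p = p and q = q]] by (simp add: simps)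
  show "\<^bold>[\<alpha>\<^bold>] (\<phi> \<^bold>\<oplus> \<phi>) \<^bold>\<leftrightarrow> (\<^bold>[\<alpha>\<^bold>] \<phi> \<^bold>\<oplus> \<^bold>[\<alpha>\<^bold>] \<phi>) \<in> PDL n"
    using inst[OF PDL.box_oplus[where \<alpha> = \<alpha> and p = p]] by (simp add: simps)
  show "\<^bold>[\<alpha>\<^bold>] (\<phi> \<^bold>\<odot> \<phi>) \<^bold>\<leftrightarrow> (\<^bold>[\<alpha>\<^bold>] \<phi> \<^bold>\<odot> \<^bold>[\<alpha>\<^bold>] \<phi>) \<in> PDL n"
    using inst[OF PDL.box_odot[where \<alpha> = \<alpha> and p = p]] by (simp add: simps)
  show "\<^bold>[Choice \<alpha> \<beta>\<^bold>] \<phi> \<^bold>\<leftrightarrow> (\<^bold>[\<alpha>\<^bold>] \<phi> \<^bold>\<and> \<^bold>[\<beta>\<^bold>] \<phi>) \<in> PDL n"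
    using inst[OF PDL.choice[where \<alpha> = \<alpha> and \<beta> = \<beta> and p = p]] by (simp add: simps)
  show "\<^bold>[Seq \<alpha> \<beta>\<^bold>] \<phi> \<^bold>\<leftrightarrow> \<^bold>[\<alpha>\<^bold>] \<^bold>[\<beta>\<^bold>] \<phi> \<in> PDL n"
    using inst[OF PDL.seq[where \<alpha> = \<alpha> and \<beta> = \<beta> and p = p]] by (simp add: simps)
  show "\<^bold>[Test \<psi>\<^bold>] \<phi> \<^bold>\<leftrightarrow> (\<^bold>\<not> (odot_power \<psi> n) \<^bold>\<or> \<phi>) \<in> PDL n"
    using inst[OF PDL.test[where p = p and q = q]] by (simp add: simps)
  show "\<^bold>[Star \<alpha>\<^bold>] \<phi> \<^bold>\<leftrightarrow> (\<phi> \<^bold>\<and> \<^bold>[\<alpha>\<^bold>] \<^bold>[Star \<alpha>\<^bold>] \<phi>) \<in> PDL n"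
    using inst[OF PDL.star_unfold[where \<alpha> = \<alpha> and p = p]] by (simp add: simps)
  show "\<^bold>[Star \<alpha>\<^bold>] \<phi> \<^bold>\<rightarrow> \<^bold>[Star \<alpha>\<^bold>] \<^bold>[Star \<alpha>\<^bold>] \<phi> \<in> PDL n"
    using inst[OF PDL.star_trans[where \<alpha> = \<alpha> and p = p]] by (simp add: simps)
  show "(\<phi> \<^bold>\<and> \<^bold>[Star \<alpha>\<^bold>] (odot_power (\<phi> \<^bold>\<rightarrow> \<^bold>[\<alpha>\<^bold>] \<phi>) n)) \<^bold>\<rightarrow> \<^bold>[Star \<alpha>\<^bold>] \<phi> \<in> PDL n"
    using inst[OF PDL.star_ind[where \<alpha> = \<alpha> and p = p]] by (simp add: simps)
qed

section \<open>The canonical model\<close>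

context
  fixes n :: nat
  assumes n: "n \<ge> 1" and inf: "infinite (UNIV :: 'p set)"
begin

lemmas entailment = pdl_theory_finite_entailment[OF n inf]

lemma equiv_pdl_equiv: "equiv UNIV (pdl_equiv n :: (('a, 'p) form \<times> ('a, 'p) form) set)"
proof (rule equivI)
  show "refl (pdl_equiv n :: (('a, 'p) form \<times> ('a, 'p) form) set)"
    by (auto simp: refl_on_def pdl_equiv_def valuation_connectives(3)
        intro!: PDL_tautology[OF n inf])
  show "sym (pdl_equiv n :: (('a, 'p) form \<times> ('a, 'p) form) set)"
  proof (rule symI)
    fix \<phi> \<psi> :: "('a, 'p) form"
    assume "(\<phi>, \<psi>) \<in> pdl_equiv n"
    then show "(\<psi>, \<phi>) \<in> pdl_equiv n" unfolding pdl_equiv_def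
      using entailment[OF pdl_theory_PDL, of "{\<phi> \<^bold>\<leftrightarrow> \<psi>}" "\<psi> \<^bold>\<leftrightarrow> \<phi>"]
      by (simp add: valuation_connectives(3))
  qed
  show "trans (pdl_equiv n :: (('a, 'p) form \<times> ('a, 'p) form) set)"
  proof (rule transI)
    fix \<phi> \<psi> \<chi> :: "('a, 'p) form"
    assume *: "(\<phi>, \<psi>) \<in> pdl_equiv n" "(\<psi>, \<chi>) \<in> pdl_equiv n"
    have "\<phi> \<^bold>\<leftrightarrow> \<chi> \<in> PDL n"
    proof (rule entailment[OF pdl_theory_PDL, of "{\<phi> \<^bold>\<leftrightarrow> \<psi>, \<psi> \<^bold>\<leftrightarrow> \<chi>}"])
      show "h (\<phi> \<^bold>\<leftrightarrow> \<chi>) = 1" if h: "h \<in> luk_valuations n"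
        and one: "\<And>\<xi>. \<xi> \<in> {\<phi> \<^bold>\<leftrightarrow> \<psi>, \<psi> \<^bold>\<leftrightarrow> \<chi>} \<Longrightarrow> h \<xi> = 1" for h
        using one[of "\<phi> \<^bold>\<leftrightarrow> \<psi>"] one[of "\<psi> \<^bold>\<leftrightarrow> \<chi>"]
        unfolding valuation_connectives[OF h] by simp
    qed (use * in \<open>simp_all add: pdl_equiv_def\<close>)
    then show "(\<phi>, \<chi>) \<in> pdl_equiv n" by (simp add: pdl_equiv_def)
  qed
qed simp

lemma canonical_val_valuation:
  assumes u: "u \<in> (canonical_worlds n :: (('a, 'p) form set \<Rightarrow> real) set)"
  shows "canonical_val n u \<in> luk_valuations n"
proof -
  have "u (pdl_class n \<phi>) \<in> Luk n" for \<phi>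
    using u by (auto simp: canonical_worlds_def Lindenbaum_def pdl_class_def intro: quotientI)
  moreover have "u (pdl_class n \<^bold>0) = 0"
    using u by (auto simp: canonical_worlds_def luk_neg_def)
  ultimately show ?thesis
    using u by (auto simp: luk_valuations_def canonical_val_def canonical_worlds_def)
qed

lemma canonical_val_PDL:
  fixes \<phi> :: "('a, 'p) form"
  assumes u: "u \<in> canonical_worlds n" and "\<phi> \<in> PDL n"
  shows "canonical_val n u \<phi> = 1"
proof -
  have "\<phi> \<^bold>\<leftrightarrow> \<^bold>1 \<in> PDL n"
  proof (rule entailment[OF pdl_theory_PDL, of "{\<phi>}"])
    show "h (\<phi> \<^bold>\<leftrightarrow> \<^bold>1) = 1" if h: "h \<in> luk_valuations n" and "\<And>\<xi>. \<xi> \<in> {\<phi>} \<Longrightarrow> h \<xi> = 1" for h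
      unfolding valuation_connectives[OF h] using that(2)[of \<phi>] valuation_simps[OF h] by simp
  qed (use assms in simp_all)
  then have "pdl_class n \<phi> = pdl_class n \<^bold>1"
    unfolding pdl_class_def by (intro equiv_class_eq[OF equiv_pdl_equiv]) (simp add: pdl_equiv_def)
  then have "canonical_val n u \<phi> = u (pdl_class n \<^bold>1)" by (simp only: canonical_val_def)
  also have "\<dots> = 1" using u unfolding canonical_worlds_def by blast
  finally show ?thesis .
qed

lemma canonical_world_of_valuation:
  fixes h :: "('a, 'p) form \<Rightarrow> real"
  assumes h: "h \<in> luk_valuations n" and PDL: "\<And>\<phi>. \<phi> \<in> PDL n \<Longrightarrow> h \<phi> = 1"
  obtains u where "u \<in> canonical_worlds n" "canonical_val n u = h"
proof -
  define u where "u = restrict (\<lambda>X. h (SOME \<phi>. \<phi> \<in> X)) (Lindenbaum n)"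
  have u: "u (pdl_class n \<phi>) = h \<phi>" for \<phi>
  proof -
    have "\<phi> \<in> pdl_class n \<phi>"
      using equiv_class_self[OF equiv_pdl_equiv] by (auto simp: pdl_class_def)
    then have "(SOME \<psi>. \<psi> \<in> pdl_class n \<phi>) \<in> pdl_class n \<phi>" by (rule someI)
    then have "\<phi> \<^bold>\<leftrightarrow> (SOME \<psi>. \<psi> \<in> pdl_class n \<phi>) \<in> PDL n"
      unfolding pdl_class_def pdl_equiv_def by blast
    then have "h \<phi> = h (SOME \<psi>. \<psi> \<in> pdl_class n \<phi>)"
      using PDL valuation_connectives(3)[OF h] by blast
    moreover have "pdl_class n \<phi> \<in> Lindenbaum n"
      by (simp add: pdl_class_def Lindenbaum_def quotientI)
    ultimately show ?thesis by (simp add: u_def)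
  qed
  have "u \<in> Lindenbaum n \<rightarrow>\<^sub>E Luk n"
    using valuation_Luk[OF h] by (auto simp: u_def)
  then have "u \<in> canonical_worlds n"
    using h by (simp add: canonical_worlds_def u luk_valuations_def luk_neg_def)
  then show thesis by (rule that) (simp add: canonical_val_def u fun_eq_iff)
qed

lemma canonical_world_eqI:
  fixes u v :: "('a, 'p) form set \<Rightarrow> real"
  assumes "u \<in> canonical_worlds n" "v \<in> canonical_worlds n"
    and eq: "\<And>\<phi>. canonical_val n u \<phi> = canonical_val n v \<phi>"
  shows "u = v"
proof (rule extensionalityI[where A = "Lindenbaum n"])
  show "u X = v X" if X: "X \<in> Lindenbaum n" for X
  proof -
    obtain \<phi> where "X = pdl_class n \<phi>"
      using X by (auto simp: Lindenbaum_def pdl_class_def elim: quotientE)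
    then show ?thesis using eq[of \<phi>] by (simp add: canonical_val_def)
  qed
qed (use assms in \<open>auto simp: canonical_worlds_def PiE_def\<close>)

lemma canonical_rel_iff:
  "(u, v) \<in> canonical_rel n \<alpha> \<longleftrightarrow> u \<in> canonical_worlds n \<and> v \<in> canonical_worlds n \<and>
    (\<forall>\<phi>. canonical_val n u (\<^bold>[\<alpha>\<^bold>] \<phi>) = 1 \<longrightarrow> canonical_val n v \<phi> = 1)"
  by (simp add: canonical_rel_def canonical_val_def)

lemma canonical_val_programs:
  fixes \<phi> \<psi> :: "('a, 'p) form"
  assumes u: "u \<in> canonical_worlds n"
  shows "canonical_val n u (\<^bold>[Choice \<alpha> \<beta>\<^bold>] \<phi>) =
      min (canonical_val n u (\<^bold>[\<alpha>\<^bold>] \<phi>)) (canonical_val n u (\<^bold>[\<beta>\<^bold>] \<phi>))"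
    and "canonical_val n u (\<^bold>[Seq \<alpha> \<beta>\<^bold>] \<phi>) = canonical_val n u (\<^bold>[\<alpha>\<^bold>] \<^bold>[\<beta>\<^bold>] \<phi>)"
    and "canonical_val n u (\<^bold>[Test \<psi>\<^bold>] \<phi>) =
      (if canonical_val n u \<psi> = 1 then canonical_val n u \<phi> else 1)"
    and "canonical_val n u (\<^bold>[Star \<alpha>\<^bold>] \<phi>) =
      min (canonical_val n u \<phi>) (canonical_val n u (\<^bold>[\<alpha>\<^bold>] \<^bold>[Star \<alpha>\<^bold>] \<phi>))"
proof -
  note h = canonical_val_valuation[OF u]
  note val = canonical_val_PDL[OF u]
  note eq = valuation_connectives(3)[OF h, THEN iffD1, OF val]
  show "canonical_val n u (\<^bold>[Choice \<alpha> \<beta>\<^bold>] \<phi>) =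
      min (canonical_val n u (\<^bold>[\<alpha>\<^bold>] \<phi>)) (canonical_val n u (\<^bold>[\<beta>\<^bold>] \<phi>))"
    using eq[OF PDL_choice[OF inf]] unfolding valuation_connectives[OF h] .
  show "canonical_val n u (\<^bold>[Seq \<alpha> \<beta>\<^bold>] \<phi>) = canonical_val n u (\<^bold>[\<alpha>\<^bold>] \<^bold>[\<beta>\<^bold>] \<phi>)"
    by (rule eq[OF PDL_seq[OF inf]])
  show "canonical_val n u (\<^bold>[Test \<psi>\<^bold>] \<phi>) =
      (if canonical_val n u \<psi> = 1 then canonical_val n u \<phi> else 1)"
    using eq[OF PDL_test[OF inf]] valuation_simps(4,5)[OF h, of \<phi>]
    unfolding valuation_connectives[OF h]
    by (simp add: valuation_simps(2)[OF h] valuation_odot_power_n[OF h n])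
  show "canonical_val n u (\<^bold>[Star \<alpha>\<^bold>] \<phi>) =
      min (canonical_val n u \<phi>) (canonical_val n u (\<^bold>[\<alpha>\<^bold>] \<^bold>[Star \<alpha>\<^bold>] \<phi>))"
    using eq[OF PDL_star_unfold[OF inf]] unfolding valuation_connectives[OF h] .
qed

lemma canonical_star_trans:
  fixes \<phi> :: "('a, 'p) form"
  assumes "u \<in> canonical_worlds n" "canonical_val n u (\<^bold>[Star \<alpha>\<^bold>] \<phi>) = 1"
  shows "canonical_val n u (\<^bold>[Star \<alpha>\<^bold>] \<^bold>[Star \<alpha>\<^bold>] \<phi>) = 1"
proof -
  note h = canonical_val_valuation[OF assms(1)]
  have "1 \<le> canonical_val n u (\<^bold>[Star \<alpha>\<^bold>] \<^bold>[Star \<alpha>\<^bold>] \<phi>)"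
    using canonical_val_PDL[OF assms(1) PDL_star_trans[OF inf]] assms(2)
    unfolding valuation_Imp[OF h] by metis
  then show ?thesis using valuation_simps(5)[OF h] by (intro antisym)
qed

lemma box_theory:
  fixes \<alpha> :: "('a, 'p) prog"
  assumes u: "u \<in> canonical_worlds n"
  shows "pdl_theory n {\<phi>. canonical_val n u (\<^bold>[\<alpha>\<^bold>] \<phi>) = 1}"
proof -
  note h = canonical_val_valuation[OF u]
  have "canonical_val n u (\<^bold>[\<alpha>\<^bold>] \<psi>) = 1"
    if "canonical_val n u (\<^bold>[\<alpha>\<^bold>] \<phi>) = 1" "canonical_val n u (\<^bold>[\<alpha>\<^bold>] (\<phi> \<^bold>\<rightarrow> \<psi>)) = 1" for \<phi> \<psi>
    using canonical_val_PDL[OF u PDL_K[OF inf, of \<alpha> \<phi> \<psi>]] that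
      valuation_simps(5)[OF h, of "\<^bold>[\<alpha>\<^bold>] \<psi>"]
    by (simp add: valuation_simps(3)[OF h])
  then show ?thesis
    unfolding pdl_theory_def using canonical_val_PDL[OF u PDL.nec] by blast
qed

lemma doubling_box:
  fixes \<alpha> :: "('a, 'p) prog"
  assumes u: "u \<in> canonical_worlds n"
  shows "doubling n (\<lambda>\<phi>. canonical_val n u (\<^bold>[\<alpha>\<^bold>] \<phi>))"
proof -
  note h = canonical_val_valuation[OF u]
  note eq = valuation_connectives(3)[OF h, THEN iffD1, OF canonical_val_PDL[OF u]]
  have "canonical_val n u (\<^bold>[\<alpha>\<^bold>] (\<phi> \<^bold>\<oplus> \<phi>)) = min 1 (2 * canonical_val n u (\<^bold>[\<alpha>\<^bold>] \<phi>))"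
    "canonical_val n u (\<^bold>[\<alpha>\<^bold>] (\<phi> \<^bold>\<odot> \<phi>)) = max 0 (2 * canonical_val n u (\<^bold>[\<alpha>\<^bold>] \<phi>) - 1)" for \<phi>
    using eq[OF PDL_box_oplus[OF inf]] eq[OF PDL_box_odot[OF inf]]
      doubling_valuation[OF h] by (simp_all add: doubling_def)
  then show ?thesis using valuation_Luk[OF h] by (simp add: doubling_def)
qed

lemma canonical_rel_le:
  fixes \<phi> :: "('a, 'p) form"
  assumes "(u, v) \<in> canonical_rel n \<alpha>"
  shows "canonical_val n u (\<^bold>[\<alpha>\<^bold>] \<phi>) \<le> canonical_val n v \<phi>"
  using assms
  by (intro doubling_le[where g = "\<lambda>\<phi>. canonical_val n u (\<^bold>[\<alpha>\<^bold>] \<phi>)" and n = n])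
    (auto simp: canonical_rel_iff intro: doubling_box doubling_valuation canonical_val_valuation)

lemma canonical_rel_extension:
  fixes D :: "('a, 'p) form set"
  assumes u: "u \<in> canonical_worlds n"
    and D: "D \<noteq> {}" "\<And>\<phi>. \<phi> \<in> D \<Longrightarrow> canonical_val n u (\<^bold>[\<alpha>\<^bold>] \<phi>) \<noteq> 1"
    and directed: "\<And>\<phi> \<psi>. \<phi> \<in> D \<Longrightarrow> \<psi> \<in> D \<Longrightarrow>
      \<exists>\<chi> \<in> D. \<phi> \<^bold>\<rightarrow> \<chi> \<in> PDL n \<and> \<psi> \<^bold>\<rightarrow> \<chi> \<in> PDL n"
  obtains v where "(u, v) \<in> canonical_rel n \<alpha>" "\<And>\<phi>. \<phi> \<in> D \<Longrightarrow> canonical_val n v \<phi> \<noteq> 1"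
proof -
  let ?T = "{\<phi>. canonical_val n u (\<^bold>[\<alpha>\<^bold>] \<phi>) = 1}"
  have PDL: "PDL n \<subseteq> ?T" using box_theory[OF u] by (simp add: pdl_theory_def)
  have "\<exists>h \<in> luk_valuations n. (\<forall>\<phi> \<in> ?T. h \<phi> = 1) \<and> (\<forall>\<phi> \<in> D. h \<phi> \<noteq> 1)"
  proof (rule pdl_theory_extension[OF n inf box_theory[OF u] D(1)])
    show "\<exists>\<chi> \<in> D. \<phi> \<^bold>\<rightarrow> \<chi> \<in> ?T \<and> \<psi> \<^bold>\<rightarrow> \<chi> \<in> ?T" if "\<phi> \<in> D" "\<psi> \<in> D" for \<phi> \<psi>
      using directed[OF that] PDL by blast
  qed (use D(2) in auto)
  then obtain h where h: "h \<in> luk_valuations n" "\<And>\<phi>. \<phi> \<in> ?T \<Longrightarrow> h \<phi> = 1"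
    "\<And>\<phi>. \<phi> \<in> D \<Longrightarrow> h \<phi> \<noteq> 1" by blast
  from canonical_world_of_valuation[OF h(1)] h(2) PDL
  obtain v where v: "v \<in> canonical_worlds n" "canonical_val n v = h" by blast
  show thesis
  proof (rule that[of v])
    show "(u, v) \<in> canonical_rel n \<alpha>" unfolding canonical_rel_iff using h(2) u v by blast
    show "canonical_val n v \<phi> \<noteq> 1" if "\<phi> \<in> D" for \<phi> using h(3)[OF that] v(2) by simp
  qed
qed

lemma canonical_box_witness:
  fixes \<phi> :: "('a, 'p) form"
  assumes u: "u \<in> canonical_worlds n" and box: "canonical_val n u (\<^bold>[\<alpha>\<^bold>] \<phi>) \<noteq> 1"
  obtains v where "(u, v) \<in> canonical_rel n \<alpha>" "canonical_val n v \<phi> = canonical_val n u (\<^bold>[\<alpha>\<^bold>] \<phi>)"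
proof -
  obtain i where i: "canonical_val n u (\<^bold>[\<alpha>\<^bold>] \<phi>) = real i / real n" "i \<le> n"
    using valuation_Luk[OF canonical_val_valuation[OF u], of "\<^bold>[\<alpha>\<^bold>] \<phi>"] by (auto simp: Luk_def)
  have "i \<noteq> n" using box i n by auto
  then obtain m k where thr: "\<And>(h :: ('a, 'p) form \<Rightarrow> real) \<phi>. doubling n h \<Longrightarrow>
      h (threshold m k \<phi>) = (if real (Suc i) / real n \<le> h \<phi> then 1 else 0)"
    using threshold_exists[of "Suc i" n] i by (metis Suc_leI le_add1 le_neq_implies_less plus_1_eq_Suc)
  have "canonical_val n u (\<^bold>[\<alpha>\<^bold>] (threshold m k \<phi>)) = 0"
    using thr[OF doubling_box[OF u]] i n by (simp add: divide_le_cancel)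
  then obtain v where v: "(u, v) \<in> canonical_rel n \<alpha>" "canonical_val n v (threshold m k \<phi>) \<noteq> 1"
    by (rule_tac canonical_rel_extension[OF u, of "{threshold m k \<phi>}" \<alpha>])
      (auto simp: valuation_simps(3) intro!: PDL_tautology[OF n inf])
  then have vW: "v \<in> canonical_worlds n" by (simp add: canonical_rel_iff)
  obtain j where j: "canonical_val n v \<phi> = real j / real n"
    using valuation_Luk[OF canonical_val_valuation[OF vW], of \<phi>] by (auto simp: Luk_def)
  have "\<not> real (Suc i) / real n \<le> real j / real n"
    using v(2) thr[OF doubling_valuation[OF canonical_val_valuation[OF vW]], of \<phi>] j
    by (auto split: if_splits)
  then have "j < Suc i"
    by (metis divide_right_mono not_less of_nat_0_le_iff of_nat_le_iff)
  then have "canonical_val n v \<phi> \<le> canonical_val n u (\<^bold>[\<alpha>\<^bold>] \<phi>)"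
    using i j by (simp add: divide_right_mono)
  with canonical_rel_le[OF v(1)] show thesis by (intro that[OF v(1)]) (rule antisym)
qed

lemma canonical_box:
  fixes \<phi> :: "('a, 'p) form"
  assumes u: "u \<in> canonical_worlds n"
  shows "canonical_val n u (\<^bold>[\<alpha>\<^bold>] \<phi>) = luk_Meet {canonical_val n v \<phi> | v. (u, v) \<in> canonical_rel n \<alpha>}"
    (is "?c = luk_Meet ?A")
proof (cases "?A = {}")
  case True
  then have "?c = 1" using canonical_box_witness[OF u] by (metis (mono_tags, lifting) empty_Collect_eq)
  with True show ?thesis by (simp add: luk_Meet_def)
next
  case False
  then obtain v where v: "(u, v) \<in> canonical_rel n \<alpha>" by blast
  have "?c \<in> ?A"
  proof (cases "?c = 1")
    case True
    then have "canonical_val n v \<phi> = ?c" using v by (simp add: canonical_rel_iff)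
    with v show ?thesis by (metis (mono_tags, lifting) mem_Collect_eq)
  next
    case False
    then show ?thesis using canonical_box_witness[OF u] by (metis (mono_tags, lifting) mem_Collect_eq)
  qed
  then have "Inf ?A = ?c" by (rule cInf_eq_minimum) (auto intro: canonical_rel_le)
  then show ?thesis by (simp only: luk_Meet_def False if_False)
qed

lemma canonical_rel_Choice:
  fixes \<alpha> \<beta> :: "('a, 'p) prog"
  shows "canonical_rel n (Choice \<alpha> \<beta>) = canonical_rel n \<alpha> \<union> canonical_rel n \<beta>"
proof (intro equalityI subrelI)
  fix u v :: "('a, 'p) form set \<Rightarrow> real"
  assume "(u, v) \<in> canonical_rel n \<alpha> \<union> canonical_rel n \<beta>"
  then have "u \<in> canonical_worlds n" by (auto simp: canonical_rel_iff)
  note bounds = valuation_simps(5)[OF canonical_val_valuation[OF this]]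
  have "canonical_val n u (\<^bold>[\<alpha>\<^bold>] \<phi>) = 1 \<and> canonical_val n u (\<^bold>[\<beta>\<^bold>] \<phi>) = 1"
    if "canonical_val n u (\<^bold>[Choice \<alpha> \<beta>\<^bold>] \<phi>) = 1" for \<phi>
    using that bounds[of "\<^bold>[\<alpha>\<^bold>] \<phi>"] bounds[of "\<^bold>[\<beta>\<^bold>] \<phi>"] canonical_val_programs(1)[OF \<open>u \<in> _\<close>]
    by (simp add: min_def split: if_splits)
  with \<open>(u, v) \<in> _\<close> show "(u, v) \<in> canonical_rel n (Choice \<alpha> \<beta>)"
    by (auto simp: canonical_rel_iff)
next
  fix u v :: "('a, 'p) form set \<Rightarrow> real"
  assume uv: "(u, v) \<in> canonical_rel n (Choice \<alpha> \<beta>)"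
  then have W: "u \<in> canonical_worlds n" "v \<in> canonical_worlds n" by (auto simp: canonical_rel_iff)
  note h = canonical_val_valuation[OF W(2)]
  show "(u, v) \<in> canonical_rel n \<alpha> \<union> canonical_rel n \<beta>"
  proof (rule ccontr)
    assume "\<not> ?thesis"
    then obtain \<phi> \<psi> where *: "canonical_val n u (\<^bold>[\<alpha>\<^bold>] \<phi>) = 1" "canonical_val n v \<phi> \<noteq> 1"
      "canonical_val n u (\<^bold>[\<beta>\<^bold>] \<psi>) = 1" "canonical_val n v \<psi> \<noteq> 1"
      using W by (auto simp: canonical_rel_iff)
    have "\<phi> \<^bold>\<or> \<psi> \<in> {\<phi>. canonical_val n u (\<^bold>[\<alpha>\<^bold>] \<phi>) = 1}"
    proof (rule entailment[OF box_theory[OF W(1)], of "{\<phi>}"])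
      show "h (\<phi> \<^bold>\<or> \<psi>) = 1" if h: "h \<in> luk_valuations n"
        and "\<And>\<xi>. \<xi> \<in> {\<phi>} \<Longrightarrow> h \<xi> = 1" for h
        unfolding valuation_connectives[OF h]
        using that(2)[of \<phi>] valuation_simps(5)[OF h] by (simp add: max_def antisym)
    qed (use * in simp_all)
    moreover have "\<phi> \<^bold>\<or> \<psi> \<in> {\<phi>. canonical_val n u (\<^bold>[\<beta>\<^bold>] \<phi>) = 1}"
    proof (rule entailment[OF box_theory[OF W(1)], of "{\<psi>}"])
      show "h (\<phi> \<^bold>\<or> \<psi>) = 1" if h: "h \<in> luk_valuations n"
        and "\<And>\<xi>. \<xi> \<in> {\<psi>} \<Longrightarrow> h \<xi> = 1" for h
        unfolding valuation_connectives[OF h]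
        using that(2)[of \<psi>] valuation_simps(5)[OF h] by (simp add: max_def antisym)
    qed (use * in simp_all)
    ultimately have "canonical_val n u (\<^bold>[Choice \<alpha> \<beta>\<^bold>] (\<phi> \<^bold>\<or> \<psi>)) = 1"
      using canonical_val_programs(1)[OF W(1)] by simp
    then have "canonical_val n v (\<phi> \<^bold>\<or> \<psi>) = 1" using uv by (simp add: canonical_rel_iff)
    with * show False unfolding valuation_connectives[OF h] by (simp add: max_def split: if_splits)
  qed
qed

lemma canonical_rel_Seq:
  fixes \<alpha> \<beta> :: "('a, 'p) prog"
  shows "canonical_rel n (Seq \<alpha> \<beta>) = canonical_rel n \<alpha> O canonical_rel n \<beta>"
proof (intro equalityI subrelI)
  fix u w :: "('a, 'p) form set \<Rightarrow> real"
  assume "(u, w) \<in> canonical_rel n \<alpha> O canonical_rel n \<beta>"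
  then show "(u, w) \<in> canonical_rel n (Seq \<alpha> \<beta>)"
    by (auto simp: canonical_rel_iff canonical_val_programs(2))
next
  fix u w :: "('a, 'p) form set \<Rightarrow> real"
  assume uw: "(u, w) \<in> canonical_rel n (Seq \<alpha> \<beta>)"
  then have W: "u \<in> canonical_worlds n" "w \<in> canonical_worlds n" by (auto simp: canonical_rel_iff)
  note h = canonical_val_valuation[OF W(2)]
  let ?D = "{\<^bold>[\<beta>\<^bold>] \<psi> | \<psi>. canonical_val n w \<psi> \<noteq> 1}"
  obtain v where v: "(u, v) \<in> canonical_rel n \<alpha>" "\<And>\<phi>. \<phi> \<in> ?D \<Longrightarrow> canonical_val n v \<phi> \<noteq> 1"
  proof (rule canonical_rel_extension[OF W(1), of ?D \<alpha>])
    have "\<^bold>[\<beta>\<^bold>] \<^bold>0 \<in> ?D" using valuation_simps(1)[OF h] by auto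
    then show "?D \<noteq> {}" by blast
    show "canonical_val n u (\<^bold>[\<alpha>\<^bold>] \<phi>) \<noteq> 1" if "\<phi> \<in> ?D" for \<phi>
      using that uw canonical_val_programs(2)[OF W(1), of \<alpha> \<beta>] by (auto simp: canonical_rel_iff)
  next
    have box_mono: "\<^bold>[\<beta>\<^bold>] \<phi> \<^bold>\<rightarrow> \<^bold>[\<beta>\<^bold>] \<psi> \<in> PDL n"
      if "\<And>h. h \<in> luk_valuations n \<Longrightarrow> h \<phi> \<le> h \<psi>" for \<phi> \<psi> :: "('a, 'p) form"
      by (rule PDL.mp[OF PDL.nec PDL_K[OF inf]], rule PDL_tautology[OF n inf])
        (use that in \<open>simp add: valuation_simps(3)\<close>)
    fix \<phi> \<psi> assume "\<phi> \<in> ?D" "\<psi> \<in> ?D"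
    then obtain \<phi>' \<psi>' where eq: "\<phi> = \<^bold>[\<beta>\<^bold>] \<phi>'" "\<psi> = \<^bold>[\<beta>\<^bold>] \<psi>'"
      and ne: "canonical_val n w \<phi>' \<noteq> 1" "canonical_val n w \<psi>' \<noteq> 1" by blast
    have "canonical_val n w (\<phi>' \<^bold>\<or> \<psi>') \<noteq> 1"
      unfolding valuation_connectives[OF h] using ne by (simp add: max_def)
    moreover have "\<phi> \<^bold>\<rightarrow> \<^bold>[\<beta>\<^bold>] (\<phi>' \<^bold>\<or> \<psi>') \<in> PDL n" unfolding eq
      by (rule box_mono) (simp only: valuation_connectives(1) max.cobounded1)
    moreover have "\<psi> \<^bold>\<rightarrow> \<^bold>[\<beta>\<^bold>] (\<phi>' \<^bold>\<or> \<psi>') \<in> PDL n" unfolding eq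
      by (rule box_mono) (simp only: valuation_connectives(1) max.cobounded2)
    ultimately show "\<exists>\<chi> \<in> ?D. \<phi> \<^bold>\<rightarrow> \<chi> \<in> PDL n \<and> \<psi> \<^bold>\<rightarrow> \<chi> \<in> PDL n" by blast
  next
    fix v
    assume "(u, v) \<in> canonical_rel n \<alpha>" and "\<And>\<phi>. \<phi> \<in> ?D \<Longrightarrow> canonical_val n v \<phi> \<noteq> 1"
    then show thesis by (rule that)
  qed
  then have "(v, w) \<in> canonical_rel n \<beta>"
    using W by (auto simp: canonical_rel_iff)
  with v show "(u, w) \<in> canonical_rel n \<alpha> O canonical_rel n \<beta>" by blast
qed

lemma canonical_rel_Test:
  fixes \<psi> :: "('a, 'p) form"
  shows "canonical_rel n (Test \<psi>) = {(u, u) | u. u \<in> canonical_worlds n \<and> canonical_val n u \<psi> = 1}"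
proof (intro equalityI subrelI)
  fix u v :: "('a, 'p) form set \<Rightarrow> real"
  assume uv: "(u, v) \<in> canonical_rel n (Test \<psi>)"
  then have W: "u \<in> canonical_worlds n" "v \<in> canonical_worlds n" by (auto simp: canonical_rel_iff)
  note hu = canonical_val_valuation[OF W(1)] and hv = canonical_val_valuation[OF W(2)]
  have "canonical_val n v \<^bold>0 \<noteq> 1" using valuation_simps(1)[OF hv] by simp
  have \<psi>: "canonical_val n u \<psi> = 1"
  proof (rule ccontr)
    assume "canonical_val n u \<psi> \<noteq> 1"
    then have "canonical_val n u (\<^bold>[Test \<psi>\<^bold>] \<^bold>0) = 1"
      using canonical_val_programs(3)[OF W(1)] by simp
    with uv \<open>canonical_val n v \<^bold>0 \<noteq> 1\<close> show False unfolding canonical_rel_iff by blast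
  qed
  then have le: "canonical_val n u \<phi> \<le> canonical_val n v \<phi>" for \<phi>
    using canonical_rel_le[OF uv, of \<phi>] canonical_val_programs(3)[OF W(1)] by simp
  have "canonical_val n u \<phi> = canonical_val n v \<phi>" for \<phi>
    using le[of \<phi>] le[of "\<^bold>\<not> \<phi>"] by (simp add: valuation_simps(2)[OF hu] valuation_simps(2)[OF hv])
  then have "u = v" by (rule canonical_world_eqI[OF W])
  with W \<psi> show "(u, v) \<in> {(u, u) | u. u \<in> canonical_worlds n \<and> canonical_val n u \<psi> = 1}" by blast
next
  fix u v :: "('a, 'p) form set \<Rightarrow> real"
  assume "(u, v) \<in> {(u, u) | u. u \<in> canonical_worlds n \<and> canonical_val n u \<psi> = 1}"
  then show "(u, v) \<in> canonical_rel n (Test \<psi>)"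
    by (auto simp: canonical_rel_iff canonical_val_programs(3))
qed

lemma canonical_rel_Star:
  fixes \<alpha> :: "('a, 'p) prog"
  shows "u \<in> canonical_worlds n \<Longrightarrow> (u, u) \<in> canonical_rel n (Star \<alpha>)"
    and "trans (canonical_rel n (Star \<alpha>))"
    and "canonical_rel n \<alpha> \<subseteq> canonical_rel n (Star \<alpha>)"
proof -
  have unfold: "canonical_val n u \<phi> = 1 \<and> canonical_val n u (\<^bold>[\<alpha>\<^bold>] \<^bold>[Star \<alpha>\<^bold>] \<phi>) = 1"
    if u: "u \<in> canonical_worlds n" and one: "canonical_val n u (\<^bold>[Star \<alpha>\<^bold>] \<phi>) = 1" for u \<phi>
    using one canonical_val_programs(4)[OF u, of \<alpha> \<phi>]
      valuation_simps(5)[OF canonical_val_valuation[OF u], of \<phi>]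
      valuation_simps(5)[OF canonical_val_valuation[OF u], of "\<^bold>[\<alpha>\<^bold>] \<^bold>[Star \<alpha>\<^bold>] \<phi>"]
    by linarith
  show "(u, u) \<in> canonical_rel n (Star \<alpha>)" if "u \<in> canonical_worlds n" for u
    using unfold that by (simp add: canonical_rel_iff)
  show "trans (canonical_rel n (Star \<alpha>))"
    using canonical_star_trans unfolding trans_def canonical_rel_iff by blast
  show "canonical_rel n \<alpha> \<subseteq> canonical_rel n (Star \<alpha>)"
    using unfold by (intro subrelI) (simp add: canonical_rel_iff)
qed

lemma canonical_worlds_nonempty: "canonical_worlds n \<noteq> ({} :: (('a, 'p) form set \<Rightarrow> real) set)"
proof -
  have zero: "\<forall>p :: 'p. (\<lambda>_. 0) p \<in> Luk n" using Luk_closed(1)[OF n] by simp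
  obtain u :: "('a, 'p) form set \<Rightarrow> real" where "u \<in> canonical_worlds n"
    using canonical_world_of_valuation[OF loop_val_valuation[OF n zero] PDL_loop_sound[OF n _ zero]]
    by blast
  then show ?thesis by blast
qed

end

theorem theorem5p12:
  fixes n :: nat
  assumes "n \<ge> 1"
    and "infinite (UNIV :: 'p::countable set)"
  shows "nonstandard_model n
           (canonical_worlds n :: (('a, 'p) form set \<Rightarrow> real) set)
           (canonical_rel n) (canonical_val n)"
  unfolding nonstandard_model_def
proof (intro conjI ballI allI)
  show "canonical_worlds n \<noteq> ({} :: (('a, 'p) form set \<Rightarrow> real) set)"
    by (rule canonical_worlds_nonempty[OF assms])
  show "canonical_rel n \<alpha> \<subseteq> canonical_worlds n \<times> canonical_worlds n" for \<alpha> :: "('a, 'p) prog"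
    by (auto simp: canonical_rel_def)
  show "canonical_rel n (Seq \<alpha> \<beta>) = canonical_rel n \<alpha> O canonical_rel n \<beta>"
    and "canonical_rel n (Choice \<alpha> \<beta>) = canonical_rel n \<alpha> \<union> canonical_rel n \<beta>"
    and "canonical_rel n (Test \<psi>) = {(u, u) | u. u \<in> canonical_worlds n \<and> canonical_val n u \<psi> = 1}"
    and "trans (canonical_rel n (Star \<alpha>))"
    and "canonical_rel n \<alpha> \<subseteq> canonical_rel n (Star \<alpha>)"
    for \<alpha> \<beta> :: "('a, 'p) prog" and \<psi> :: "('a, 'p) form"
    by (rule canonical_rel_Seq[OF assms] canonical_rel_Choice[OF assms]
        canonical_rel_Test[OF assms] canonical_rel_Star[OF assms])+
  fix w :: "('a, 'p) form set \<Rightarrow> real" and \<alpha> :: "('a, 'p) prog" and \<phi> \<psi> p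
  assume w: "w \<in> canonical_worlds n"
  note h = canonical_val_valuation[OF assms w]
  show "canonical_val n w (PVar p) \<in> Luk n" by (rule valuation_Luk[OF h])
  show "canonical_val n w \<^bold>0 = 0"
    and "canonical_val n w (\<phi> \<^bold>\<rightarrow> \<psi>) = luk_imp (canonical_val n w \<phi>) (canonical_val n w \<psi>)"
    and "canonical_val n w (\<^bold>\<not> \<psi>) = luk_neg (canonical_val n w \<psi>)"
    using h by (auto simp: luk_valuations_def)
  show "canonical_val n w (\<^bold>[\<alpha>\<^bold>] \<psi>) = luk_Meet {canonical_val n v \<psi> | v. (w, v) \<in> canonical_rel n \<alpha>}"
    by (rule canonical_box[OF assms w])
  show "(w, w) \<in> canonical_rel n (Star \<alpha>)" by (rule canonical_rel_Star(1)[OF assms w])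
  have "canonical_val n w (\<^bold>[Star \<alpha>\<^bold>] \<phi>) = canonical_val n w (\<phi> \<^bold>\<and> \<^bold>[\<alpha>\<^bold>] \<^bold>[Star \<alpha>\<^bold>] \<phi>)"
    unfolding valuation_connectives[OF h] by (rule canonical_val_programs(4)[OF assms w])
  then show "canonical_val n w (\<^bold>[Star \<alpha>\<^bold>] \<phi> \<^bold>\<rightarrow> (\<phi> \<^bold>\<and> \<^bold>[\<alpha>\<^bold>] \<^bold>[Star \<alpha>\<^bold>] \<phi>)) = 1"
    unfolding valuation_simps(3)[OF h, of "\<^bold>[Star \<alpha>\<^bold>] \<phi>"] by simp
  show "canonical_val n w (\<^bold>[Star \<alpha>\<^bold>] \<phi> \<^bold>\<rightarrow> \<^bold>[Star \<alpha>\<^bold>] \<^bold>[Star \<alpha>\<^bold>] \<phi>) = 1"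
    and "canonical_val n w ((\<phi> \<^bold>\<and> \<^bold>[Star \<alpha>\<^bold>] (odot_power (\<phi> \<^bold>\<rightarrow> \<^bold>[\<alpha>\<^bold>] \<phi>) n)) \<^bold>\<rightarrow> \<^bold>[Star \<alpha>\<^bold>] \<phi>) = 1"
    by (rule canonical_val_PDL[OF assms w], rule PDL_star_trans[OF assms(2)] PDL_star_ind[OF assms(2)])+
qed

end
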